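(* Let $0\le k\le n$ and let $D$ be a $\mathsf{Sq}$-diagram fitting inside a $k\times(n-k)$ box. Let $N_D$ be the network of $D$ (with any choice of positive real weights on its horizontal edges), let $\operatorname{Meas}(N_D)$ be its boundary measurement matrix, and let $M_{\operatorname{Meas}(N_D)}$ be the corresponding positroid. Then $M_{\operatorname{Meas}(N_D)}$ is a fundamental transversal matroid satisfying $$M_{\operatorname{Meas}(N_D)} = M[\operatorname{supp}(\operatorname{Meas}(N_D))],$$ where $\operatorname{supp}(\operatorname{Meas}(N_D))$ is a noncrossing minimal presentation.
   Context: $[n]=\{1,\dots,n\}$. **Diagrams.** Young diagrams are left-justified with the largest part on top; box $(i,j)$ is in row $i$ (increasing downward) and column $j$ (increasing to the right). A $\mathsf{Le}$-diagram is a filling of a Young diagram in which each box is either empty or contains $\bullet$, such that for $i<i'$ and $j<j'$: if box $(i',j')$ exists and boxes $(i,j')$ and $(i',j)$ both contain $\bullet$, then $(i',j')$ contains $\bullet$. A $\mathsf{Sq}$-diagram is a $\mathsf{Le}$-diagram such that in addition, for $i<i'$ and $j<j'$: if $(i,j')$, $(i',j)$ and $(i',j')$ all contain $\bullet$, then $(i,j)$ contains $\bullet$. Diagrams fitting inside a $k\times(n-k)$ box have at most $k$ rows, each of length at most $n-k$ (rows of the box of length $0$ in the diagram, and columns of the box not meeting the diagram, are allowed). **The network $N_D$.** The southeast border of $D$ inside the $k\times(n-k)$ box (together, where needed, with parts of the top and left sides of the box) is a lattice path from the top right corner to the bottom left corner of the box. Place a boundary vertex on each of its $n$ steps, labeled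 $1,\dots,n$ in order starting from the top right. Vertical steps are sources (one for each row), horizontal steps are sinks (one for each column). Each $\bullet$ is an internal vertex. From each source or internal vertex, a directed edge is drawn leftward to the nearest internal vertex to the left in the same row, if there is one; it carries a positive real weight. From each internal vertex a directed edge of weight $1$ is drawn downward to the nearest internal vertex below it in the same column, or to the sink of that column if there is none. This is an acyclic planar network in a disk. **Boundary measurement matrix.** If $K\subseteq[n]$ is the set of sources, $\operatorname{Meas}(N_D)$ is the $K\times[n]$ matrix with entries $\operatorname{Meas}(N_D)_{ij}=\sum_{P:i\rightsquigarrow j}(-1)^{s_{ij}}\prod_{e\in P}w_e$, the sum being over directed paths $P$ from $i$ to $j$, where $w_e$ is the weight of $e$ and $s_{ij}$ is the number of sources strictly between $i$ and $j$. The empty path gives $\operatorname{Meas}(N_D)_{ii}=1$ for $i\in K$. **Matroids.** For a full-rank real $k\times n$ matrix $A$, $M_A$ is the matroid on $[n]$ whose bases are the $k$-subsets indexing nonvanishing maximal minors of $A$. The positroid associated with $D$ is $M_{\operatorname{Meas}(N_D)}$. For $A$ with rows $r_1,\dots,r_k$, $\operatorname{supp}(A)=(\operatorname{supp}(r_1),\dots,\operatorname{supp}(r_k))$, where $\operatorname{supp}(r)$ is the set of indices of nonzero entries of $r$. **Transversal matroids.** A set system $(S_1,\dots,S_k)$ is a family of subsets of a ground set $E$, repetitions allowed, considered up to reordering. A transversal is a set $I\subseteq E$ with a bijection $\phi:[k]\to I$ such that $\phi(j)\in S_j$ for all $j$. All set systems are assumed to have a transversal. $M[(S_1,\dots,S_k)]$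 is the matroid whose bases are the transversals; such a matroid is called transversal and $(S_1,\dots,S_k)$ is a presentation of it (presentations of rank $k$ matroids always use exactly $k$ sets). A presentation $(S_1,\dots,S_k)$ is minimal if whenever $(S'_1,\dots,S'_k)$ is a presentation of the same matroid with, after some reordering, $S'_i\subseteq S_i$ for all $i$, then the two set systems are equal. A transversal matroid is fundamental if it has a presentation $(S_1,\dots,S_k)$ such that for each $i$ there is $e\in S_i$ with $e\notin S_j$ for all $j\ne i$. **Noncrossing.** For $a\in[n]$, let $<_a$ be the total order $a<_a a+1<_a\cdots<_a n<_a 1<_a\cdots<_a a-1$. For $S,T\subseteq[n]$, $S$ crosses $T$ if there are $a,b,c,d\in[n]$ with $a<_a b<_a c<_a d$, $a,c\in S$, $a,c\notin T$, $b,d\in T$, and $b\notin S$. A set system is crossing if $S_i$ crosses $S_j$ for some $i,j$, and noncrossing otherwise. *)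

theory Defs
  imports
    "Jordan_Normal_Form.Determinant"
    "Jordan_Normal_Form.DL_Submatrix"
    "Graph_Theory.Arc_Walk"
    "HOL-Library.Multiset"
begin

section \<open>Diagrams\<close>

text \<open>A diagram is a set \<open>Y\<close> of boxes (row, column), both indices starting at 1, together with
  the set \<open>B\<close> of those boxes that contain a bullet.\<close>

definition young_diagram :: "(nat \<times> nat) set \<Rightarrow> bool" where
  "young_diagram Y \<longleftrightarrow> finite Y \<and>
     (\<forall>i j. (i, j) \<in> Y \<longrightarrow> 1 \<le> i \<and> 1 \<le> j \<and> {1..i} \<times> {1..j} \<subseteq> Y)"

definition le_diagram :: "(nat \<times> nat) set \<Rightarrow> (nat \<times> nat) set \<Rightarrow> bool" where
  "le_diagram Y B \<longleftrightarrow> young_diagram Y \<and> B \<subseteq> Y \<and>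
     (\<forall>i i' j j'. i < i' \<and> j < j' \<and> (i', j') \<in> Y \<and> (i, j') \<in> B \<and> (i', j) \<in> B
        \<longrightarrow> (i', j') \<in> B)"

definition sq_diagram :: "(nat \<times> nat) set \<Rightarrow> (nat \<times> nat) set \<Rightarrow> bool" where
  "sq_diagram Y B \<longleftrightarrow> le_diagram Y B \<and>
     (\<forall>i i' j j'. i < i' \<and> j < j' \<and> (i, j') \<in> B \<and> (i', j) \<in> B \<and> (i', j') \<in> B
        \<longrightarrow> (i, j) \<in> B)"

definition fits_in_box :: "(nat \<times> nat) set \<Rightarrow> nat \<Rightarrow> nat \<Rightarrow> bool" where
  "fits_in_box Y k m \<longleftrightarrow> Y \<subseteq> {1..k} \<times> {1..m}"

definition row_length :: "(nat \<times> nat) set \<Rightarrow> nat \<Rightarrow> nat" where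
  "row_length Y i = card {j. (i, j) \<in> Y}"

definition col_length :: "(nat \<times> nat) set \<Rightarrow> nat \<Rightarrow> nat" where
  "col_length Y j = card {i. (i, j) \<in> Y}"


section \<open>The network of a diagram\<close>

text \<open>The southeast border is walked from the top right to the bottom left corner of the
  \<open>k \<times> m\<close> box. Up to and including its vertical step in row \<open>i\<close> it makes \<open>i\<close> vertical steps
  and \<open>m - row_length Y i\<close> horizontal ones (in the columns \<open>> row_length Y i\<close>); up to and
  including its horizontal step in column \<open>j\<close> it makes \<open>m - j + 1\<close> horizontal steps and
  \<open>col_length Y j\<close> vertical ones.\<close>

definition source_label :: "nat \<Rightarrow> (nat \<times> nat) set \<Rightarrow> nat \<Rightarrow> nat" where
  "source_label m Y i = (m - row_length Y i) + i"

definition sink_label :: "nat \<Rightarrow> (nat \<times> nat) set \<Rightarrow> nat \<Rightarrow> nat" where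
  "sink_label m Y j = (m - j + 1) + col_length Y j"

definition sources :: "nat \<Rightarrow> nat \<Rightarrow> (nat \<times> nat) set \<Rightarrow> nat set" where
  "sources k n Y = source_label (n - k) Y ` {1..k}"

datatype net_vertex = Boundary nat | Internal nat nat

definition horizontal_arcs ::
    "nat \<Rightarrow> nat \<Rightarrow> (nat \<times> nat) set \<Rightarrow> (nat \<times> nat) set \<Rightarrow> (net_vertex \<times> net_vertex) set" where
  "horizontal_arcs k n Y B =
     {(Boundary (source_label (n - k) Y i), Internal i j) | i j.
        i \<in> {1..k} \<and> (i, j) \<in> B \<and> (\<forall>l > j. (i, l) \<notin> B)}
   \<union> {(Internal i j, Internal i j') | i j j'.
        j' < j \<and> (i, j) \<in> B \<and> (i, j') \<in> B \<and> (\<forall>l. j' < l \<and> l < j \<longrightarrow> (i, l) \<notin> B)}"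

definition vertical_arcs ::
    "nat \<Rightarrow> nat \<Rightarrow> (nat \<times> nat) set \<Rightarrow> (nat \<times> nat) set \<Rightarrow> (net_vertex \<times> net_vertex) set" where
  "vertical_arcs k n Y B =
     {(Internal i j, Internal i' j) | i i' j.
        i < i' \<and> (i, j) \<in> B \<and> (i', j) \<in> B \<and> (\<forall>l. i < l \<and> l < i' \<longrightarrow> (l, j) \<notin> B)}
   \<union> {(Internal i j, Boundary (sink_label (n - k) Y j)) | i j.
        (i, j) \<in> B \<and> (\<forall>l > i. (l, j) \<notin> B)}"

definition network ::
    "nat \<Rightarrow> nat \<Rightarrow> (nat \<times> nat) set \<Rightarrow> (nat \<times> nat) set
      \<Rightarrow> (net_vertex, net_vertex \<times> net_vertex) pre_digraph" where
  "network k n Y B =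
     \<lparr> verts = Boundary ` {1..n} \<union> {Internal i j | i j. (i, j) \<in> B},
       arcs = horizontal_arcs k n Y B \<union> vertical_arcs k n Y B,
       tail = fst, head = snd \<rparr>"

definition network_weighting ::
    "nat \<Rightarrow> nat \<Rightarrow> (nat \<times> nat) set \<Rightarrow> (nat \<times> nat) set
      \<Rightarrow> (net_vertex \<times> net_vertex \<Rightarrow> real) \<Rightarrow> bool" where
  "network_weighting k n Y B w \<longleftrightarrow>
     (\<forall>e \<in> horizontal_arcs k n Y B. w e > 0) \<and> (\<forall>e \<in> vertical_arcs k n Y B. w e = 1)"


section \<open>The boundary measurement matrix\<close>

definition meas_entry ::
    "nat \<Rightarrow> nat \<Rightarrow> (nat \<times> nat) set \<Rightarrow> (nat \<times> nat) set \<Rightarrow> (net_vertex \<times> net_vertex \<Rightarrow> real)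
      \<Rightarrow> nat \<Rightarrow> nat \<Rightarrow> real" where
  "meas_entry k n Y B w i j =
     (\<Sum>P | pre_digraph.apath (network k n Y B) (Boundary i) P (Boundary j).
        (- 1) ^ card {s \<in> sources k n Y. min i j < s \<and> s < max i j} * prod_list (map w P))"

text \<open>Matrix indices start at 0: column \<open>c\<close> belongs to the boundary vertex \<open>c + 1\<close>, and row
  \<open>r\<close> to the source in row \<open>r + 1\<close> of the box. As \<open>source_label\<close> is strictly increasing in the
  row, the sources appear in increasing order.\<close>

definition Meas ::
    "nat \<Rightarrow> nat \<Rightarrow> (nat \<times> nat) set \<Rightarrow> (nat \<times> nat) set \<Rightarrow> (net_vertex \<times> net_vertex \<Rightarrow> real)
      \<Rightarrow> real mat" where
  "Meas k n Y B w =
     mat k n (\<lambda>(r, c). meas_entry k n Y B w (source_label (n - k) Y (r + 1)) (c + 1))"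


section \<open>Matroids\<close>

record 'a matroid_data =
  ground :: "'a set"
  bases :: "'a set set"

definition is_matroid :: "'a matroid_data \<Rightarrow> bool" where
  "is_matroid M \<longleftrightarrow> finite (ground M) \<and> bases M \<subseteq> Pow (ground M) \<and> bases M \<noteq> {} \<and>
     (\<forall>I \<in> bases M. \<forall>J \<in> bases M. \<forall>x \<in> I - J. \<exists>y \<in> J - I. insert y (I - {x}) \<in> bases M)"

text \<open>The element \<open>e\<close> of the ground set labels the column with matrix index \<open>e - 1\<close>.\<close>

definition matroid_of_matrix :: "real mat \<Rightarrow> nat matroid_data" where
  "matroid_of_matrix A =
     \<lparr> ground = {1..dim_col A},
       bases = {I. I \<subseteq> {1..dim_col A} \<and> card I = dim_row A
                 \<and> det (submatrix A UNIV {c. c + 1 \<in> I}) \<noteq> 0} \<rparr>"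

definition supp :: "real mat \<Rightarrow> nat set list" where
  "supp A = map (\<lambda>r. {c + 1 | c. c < dim_col A \<and> A $$ (r, c) \<noteq> 0}) [0..<dim_row A]"


section \<open>Transversal matroids\<close>

text \<open>A set system is a list of sets; two lists are the same set system if they have the same
  multiset of entries. All notions below are invariant under reordering.\<close>

definition is_transversal :: "'a set list \<Rightarrow> 'a set \<Rightarrow> bool" where
  "is_transversal S I \<longleftrightarrow>
     (\<exists>\<phi>. bij_betw \<phi> {..<length S} I \<and> (\<forall>j < length S. \<phi> j \<in> S ! j))"

definition matroid_of_system :: "'a set \<Rightarrow> 'a set list \<Rightarrow> 'a matroid_data" where
  "matroid_of_system E S = \<lparr> ground = E, bases = {I. I \<subseteq> E \<and> is_transversal S I} \<rparr>"

definition presentation :: "'a set list \<Rightarrow> 'a matroid_data \<Rightarrow> bool" where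
  "presentation S M \<longleftrightarrow>
     (\<forall>X \<in> set S. X \<subseteq> ground M) \<and> (\<exists>I. is_transversal S I)
     \<and> M = matroid_of_system (ground M) S"

definition minimal_presentation :: "'a set list \<Rightarrow> 'a matroid_data \<Rightarrow> bool" where
  "minimal_presentation S M \<longleftrightarrow> presentation S M \<and>
     (\<forall>S'. presentation S' M \<and> (\<exists>T. mset T = mset S' \<and> list_all2 (\<subseteq>) T S)
        \<longrightarrow> mset S' = mset S)"

definition transversal_matroid :: "'a matroid_data \<Rightarrow> bool" where
  "transversal_matroid M \<longleftrightarrow> is_matroid M \<and> (\<exists>S. presentation S M)"

definition fundamental_transversal_matroid :: "'a matroid_data \<Rightarrow> bool" where
  "fundamental_transversal_matroid M \<longleftrightarrow> transversal_matroid M \<and>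
     (\<exists>S. presentation S M \<and>
        (\<forall>i < length S. \<exists>e \<in> S ! i. \<forall>j < length S. j \<noteq> i \<longrightarrow> e \<notin> S ! j))"


section \<open>Noncrossing set systems\<close>

text \<open>The total order \<open>a, a + 1, \<dots>, n, 1, \<dots>, a - 1\<close>.\<close>

definition cyclic_less :: "nat \<Rightarrow> nat \<Rightarrow> nat \<Rightarrow> bool" where
  "cyclic_less a x y \<longleftrightarrow> (a \<le> x \<and> x < y) \<or> (a \<le> x \<and> y < a) \<or> (x < y \<and> y < a)"

definition crosses :: "nat \<Rightarrow> nat set \<Rightarrow> nat set \<Rightarrow> bool" where
  "crosses n S T \<longleftrightarrow>
     (\<exists>a \<in> {1..n}. \<exists>b \<in> {1..n}. \<exists>c \<in> {1..n}. \<exists>d \<in> {1..n}.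
        cyclic_less a a b \<and> cyclic_less a b c \<and> cyclic_less a c d \<and>
        a \<in> S \<and> c \<in> S \<and> a \<notin> T \<and> c \<notin> T \<and> b \<in> T \<and> d \<in> T \<and> b \<notin> S)"

definition noncrossing :: "nat \<Rightarrow> nat set list \<Rightarrow> bool" where
  "noncrossing n S \<longleftrightarrow>
     \<not> (\<exists>i < length S. \<exists>j < length S. crosses n (S ! i) (S ! j))"

end

theory Submission
  imports Defs
begin

text \<open>Add the bullets in reading order: rows from top to bottom, each row from right to left. A new
  bullet changes a single column of the boundary measurement matrix: to the column of its sink is
  added a positive multiple of the column of the preceding vertex of the row (a sink to its right,
  or the source of the row), up to a sign. By the Le condition, all labels between these two are
  either sources of empty rows or zero columns, so the signs cancel and every maximal minor is
  either unchanged or becomes a sum of an old minor and a positive multiple of another one. The Sq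
  condition makes the transversals of the row supports obey the same recursion, so all maximal
  minors are nonnegative and vanish exactly on the non-transversals. Minimality holds since each
  source lies in the support of its own row only.\<close>

section \<open>Determinants of selected columns\<close>

text \<open>Strict positivity makes the induction close: in the sum of an old minor and a multiple
  of another one, two merely nonzero terms could cancel, two nonnegative ones cannot. Only
  positivity has to be propagated. A minor without a transversal vanishes at every stage, because
  each nonzero term of its Leibniz expansion would be a transversal. The Sq condition acts on
  supports. If the next bullet to the right of a new bullet \<open>(r, j)\<close> is
  \<open>(r, j')\<close>, then paths that turn left there may start in any row \<open>i\<close> with
  a bullet in column \<open>j'\<close>; the condition forces a bullet at \<open>(i, j)\<close> as
  well. So each source reaches exactly the columns with a bullet in its own row, and a new bullet
  adds a single label to a single row support. The inductive predicate \<open>sq_matrix\<close>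
  separates the paths from the determinants. A path to a bullet passes only through bullets that
  come earlier in the reading order, so the weights for an initial set of bullets can be taken in
  the full network, which is never truncated.\<close>

definition column_det :: "(nat \<Rightarrow> nat \<Rightarrow> real) \<Rightarrow> nat list \<Rightarrow> real" where
  "column_det a zs = det (mat (length zs) (length zs) (\<lambda>(i, t). a i (zs ! t)))"

text \<open>Bases are sets, but determinants are taken over lists, where a column can be moved to
  the front, replaced in place or repeated.\<close>

definition minor :: "(nat \<Rightarrow> nat \<Rightarrow> real) \<Rightarrow> nat set \<Rightarrow> real" where
  "minor a I = column_det a (sorted_list_of_set I)"

text \<open>The coefficient of the row \<open>i\<close> entry of a column placed in front of
  \<open>xs\<close>. It depends on \<open>xs\<close> alone, so \<open>column_det a (c # xs)\<close>
  is linear in column \<open>c\<close>; adding a column and exchanging basis elements both rest on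
  this.\<close>

definition column_cofactor :: "(nat \<Rightarrow> nat \<Rightarrow> real) \<Rightarrow> nat list \<Rightarrow> nat \<Rightarrow> real" where
  "column_cofactor a xs i = (- 1) ^ i * column_det (\<lambda>p. a (if p < i then p else Suc p)) xs"

lemma column_det_cong:
  assumes "\<And>i x. i < length zs \<Longrightarrow> x \<in> set zs \<Longrightarrow> a i x = b i x"
  shows "column_det a zs = column_det b zs"
proof -
  have "mat (length zs) (length zs) (\<lambda>(i, t). a i (zs ! t))
      = mat (length zs) (length zs) (\<lambda>(i, t). b i (zs ! t))"
    using assms by (intro eq_matI) auto
  then show ?thesis by (simp add: column_det_def)
qed

lemma column_det_expand:
  "column_det a (us @ c # vs) =
     (- 1) ^ length us * (\<Sum>i \<le> length us + length vs. a i c * column_cofactor a (us @ vs) i)"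
proof -
  define k where "k = length us + length vs"
  define M where "M = mat (Suc k) (Suc k) (\<lambda>(i, t). a i ((us @ c # vs) ! t))"
  have M: "M \<in> carrier_mat (Suc k) (Suc k)" by (simp add: M_def)
  have cof: "cofactor M i (length us) = (- 1) ^ length us * column_cofactor a (us @ vs) i"
    if "i < Suc k" for i
  proof -
    have "mat_delete M i (length us) =
        mat k k (\<lambda>(p, t). a (if p < i then p else Suc p) ((us @ vs) ! t))"
      unfolding mat_delete_def M_def k_def
      by (intro eq_matI) (auto simp: nth_append)
    then show ?thesis
      by (simp add: cofactor_def column_cofactor_def column_det_def k_def power_add mult_ac)
  qed
  have "column_det a (us @ c # vs) = det M"
    by (simp add: column_det_def M_def k_def)
  also have "\<dots> = (\<Sum>i<Suc k. M $$ (i, length us) * cofactor M i (length us))"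
    by (rule laplace_expansion_column[OF M]) (simp add: k_def)
  also have "\<dots> = (\<Sum>i<Suc k. a i c * ((- 1) ^ length us * column_cofactor a (us @ vs) i))"
    by (intro sum.cong refl arg_cong2[where f = "(*)"] cof) (auto simp: M_def k_def nth_append)
  also have "\<dots> = (- 1) ^ length us * (\<Sum>i \<le> k. a i c * column_cofactor a (us @ vs) i)"
    by (simp only: sum_distrib_left lessThan_Suc_atMost) (simp add: mult_ac)
  finally show ?thesis by (simp add: k_def)
qed

lemma column_det_Cons:
  "column_det a (c # xs) = (\<Sum>i \<le> length xs. a i c * column_cofactor a xs i)"
  using column_det_expand[of a "[]"] by simp

text \<open>Both sides expand along \<open>c\<close> with the cofactors of the same list
  \<open>us @ vs\<close>, so only the sign of the position differs.\<close>

lemma column_det_move: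
  "column_det a (us @ c # vs) = (- 1) ^ length us * column_det a (c # us @ vs)"
  by (simp add: column_det_expand column_det_Cons)

lemma column_det_repeated:
  assumes "c \<in> set xs"
  shows "column_det a (c # xs) = 0"
proof -
  obtain t where t: "t < length xs" "xs ! t = c" using assms by (auto simp: in_set_conv_nth)
  let ?M = "mat (length (c # xs)) (length (c # xs)) (\<lambda>(i, t). a i ((c # xs) ! t))"
  have "det ?M = 0"
  proof (rule det_identical_columns)
    show "?M \<in> carrier_mat (length (c # xs)) (length (c # xs))" by simp
    show "col ?M 0 = col ?M (Suc t)" using t by (intro eq_vecI) auto
  qed (use t in auto)
  then show ?thesis by (simp add: column_det_def)
qed

lemma column_det_add_column:
  assumes "\<And>i. i \<le> length xs \<Longrightarrow> a i c = b i c + q * b i c'"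
    and "\<And>i x. i \<le> length xs \<Longrightarrow> x \<in> set xs \<Longrightarrow> a i x = b i x"
  shows "column_det a (c # xs) = column_det b (c # xs) + q * column_det b (c' # xs)"
proof -
  have cof: "column_cofactor a xs i = column_cofactor b xs i" for i
    unfolding column_cofactor_def
    by (intro arg_cong2[where f = "(*)"] refl column_det_cong) (auto intro!: assms(2))
  show ?thesis
    by (simp add: column_det_Cons cof assms(1) algebra_simps sum.distrib sum_distrib_left)
qed

lemma minor_cong:
  assumes "finite I" "\<And>i x. i < card I \<Longrightarrow> x \<in> I \<Longrightarrow> a i x = b i x"
  shows "minor a I = minor b I"
  unfolding minor_def using assms by (intro column_det_cong) auto

lemma sorted_list_of_set_insert_split:
  fixes c :: "'a :: linorder"
  assumes "finite J" "c \<notin> J"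
  obtains us vs where "sorted_list_of_set (insert c J) = us @ c # vs"
    "sorted_list_of_set J = us @ vs" "length us = card {x \<in> J. x < c}"
proof
  let ?us = "sorted_list_of_set {x \<in> J. x < c}" and ?vs = "sorted_list_of_set {x \<in> J. c < x}"
  have J: "x < c \<or> c < x" if "x \<in> J" for x
    using that assms(2) by (metis linorder_neqE)
  have "insert c J = set (?us @ c # ?vs)" "J = set (?us @ ?vs)"
    using assms J by auto
  moreover have "sorted (?us @ c # ?vs)" "distinct (?us @ c # ?vs)"
    using assms by (auto simp: sorted_append)
  moreover have "sorted (?us @ ?vs)" "distinct (?us @ ?vs)"
    using assms by (auto simp: sorted_append)
  ultimately show "sorted_list_of_set (insert c J) = ?us @ c # ?vs" "sorted_list_of_set J = ?us @ ?vs"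
    by (metis sorted_list_of_set.idem_if_sorted_distinct)+
qed (use assms in simp)

lemma minor_insert:
  assumes "finite J" "c \<notin> J"
  shows "minor a (insert c J) =
    (- 1) ^ card {x \<in> J. x < c} * column_det a (c # sorted_list_of_set J)"
  unfolding minor_def
  by (rule sorted_list_of_set_insert_split[OF assms]) (simp only: column_det_move)

lemma column_det_sorted_insert:
  assumes "finite J" "c \<notin> J"
  shows "column_det a (c # sorted_list_of_set J) =
    (- 1) ^ card {x \<in> J. x < c} * minor a (insert c J)"
  unfolding minor_insert[OF assms] by (simp flip: mult.assoc power_add add: power_even_eq mult_2)

text \<open>\<open>is_transversal\<close> for a family given as a function, so that enlarging one
  set is a pointwise condition.\<close>

definition has_transversal :: "nat \<Rightarrow> (nat \<Rightarrow> 'a set) \<Rightarrow> 'a set \<Rightarrow> bool" where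
  "has_transversal k U I \<longleftrightarrow> (\<exists>\<phi>. bij_betw \<phi> {..<k} I \<and> (\<forall>i<k. \<phi> i \<in> U i))"

text \<open>A nonzero term of the Leibniz expansion chooses one nonzero entry in each row, in
  distinct columns; sending rows to the chosen labels is a transversal.\<close>

lemma minor_nonzero_transversal:
  assumes "finite I" "card I = k" "minor a I \<noteq> 0"
    and "\<And>i x. i < k \<Longrightarrow> x \<in> I \<Longrightarrow> a i x \<noteq> 0 \<Longrightarrow> x \<in> U i"
  shows "has_transversal k U I"
proof -
  define zs where "zs = sorted_list_of_set I"
  have zs: "length zs = k" "set zs = I" "distinct zs" using assms by (simp_all add: zs_def)
  have "det (mat k k (\<lambda>(i, t). a i (zs ! t))) \<noteq> 0"
    using assms(3) zs by (simp add: minor_def column_det_def flip: zs_def)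
  then obtain p where p: "p permutes {0..<k}" "(\<Prod>i = 0..<k. a i (zs ! p i)) \<noteq> 0"
    by (subst (asm) det_def'[of _ k]) (auto elim!: sum.not_neutral_contains_not_neutral)
  let ?\<phi> = "\<lambda>i. zs ! p i"
  have "bij_betw ((!) zs \<circ> p) {..<k} I"
  proof (rule bij_betw_trans)
    show "bij_betw p {..<k} {..<k}" using permutes_imp_bij[OF p(1)] by (simp add: atLeast0LessThan)
    show "bij_betw ((!) zs) {..<k} I" using zs by (intro bij_betw_nth) auto
  qed
  moreover have "?\<phi> i \<in> U i" if "i < k" for i
  proof (rule assms(4)[OF that])
    have "p i < k" using permutes_in_image[OF p(1)] that by simp
    then show "?\<phi> i \<in> I" using zs nth_mem by metis
    show "a i (zs ! p i) \<noteq> 0" using p(2) that by auto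
  qed
  ultimately show ?thesis by (auto simp: has_transversal_def o_def)
qed

section \<open>Minors and transversals\<close>

definition positive_on_transversals ::
    "nat \<Rightarrow> (nat \<Rightarrow> nat \<Rightarrow> real) \<Rightarrow> (nat \<Rightarrow> nat set) \<Rightarrow> bool" where
  "positive_on_transversals k a U \<longleftrightarrow>
     (\<forall>I. finite I \<and> card I = k \<longrightarrow>
        (if has_transversal k U I then 0 < minor a I else minor a I = 0))"

lemma positive_on_transversals_nonneg:
  assumes "positive_on_transversals k a U" "finite I" "card I = k"
  shows "0 \<le> minor a I"
  using assms by (auto simp: positive_on_transversals_def split: if_splits intro: less_imp_le)

lemma has_transversal_exchange:
  assumes \<phi>: "bij_betw \<phi> {..<k} I" "\<forall>i<k. \<phi> i \<in> U i" and "i < k"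
    and c: "c \<in> U i" "c \<notin> I"
  shows "has_transversal k U (insert c (I - {\<phi> i}))"
  unfolding has_transversal_def
proof (intro exI conjI)
  have "bij_betw \<phi> ({..<k} - {i}) (I - {\<phi> i})"
    using \<phi>(1) \<open>i < k\<close> by (intro bij_betw_subset[OF \<phi>(1)]) (auto simp: bij_betw_def inj_on_def)
  then have "bij_betw (\<phi>(i := c)) ({..<k} - {i}) (I - {\<phi> i})"
    by (rule bij_betw_cong[THEN iffD1, rotated]) auto
  then have "bij_betw (\<phi>(i := c)) (insert i ({..<k} - {i})) (insert c (I - {\<phi> i}))"
    using notIn_Un_bij_betw[of i "{..<k} - {i}" "\<phi>(i := c)" "I - {\<phi> i}"] c by simp
  then show "bij_betw (\<phi>(i := c)) {..<k} (insert c (I - {\<phi> i}))"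
    using \<open>i < k\<close> by (simp add: insert_absorb)
qed (use \<phi> c in auto)

lemma has_transversal_swap:
  assumes \<phi>: "bij_betw \<phi> {..<k} I" and ij: "i < k" "j < k"
    and "\<phi> i \<in> U j" "\<phi> j \<in> U i" "\<And>l. l < k \<Longrightarrow> l \<noteq> i \<Longrightarrow> l \<noteq> j \<Longrightarrow> \<phi> l \<in> U l"
  shows "has_transversal k U I"
  unfolding has_transversal_def
proof (intro exI conjI)
  have "bij_betw (transpose i j) {..<k} {..<k}"
    using ij by (intro permutes_imp_bij permutes_swap_id) auto
  from bij_betw_trans[OF this \<phi>] show "bij_betw (\<phi> \<circ> transpose i j) {..<k} I" .
  show "\<forall>l<k. (\<phi> \<circ> transpose i j) l \<in> U l"
    using assms by (auto simp: transpose_def)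
qed

text \<open>The effect of one bullet, stripped of diagrams: \<open>c\<close> is the label of its
  sink, \<open>c'\<close> the label it is reached from, \<open>p\<close> its row, and
  \<open>Z\<close> the sources in between. For a transversal \<open>I\<close> containing
  \<open>c\<close> there are two cases. If \<open>c'\<close> is in \<open>I\<close>, the correction
  repeats a column and the minor does not change. Otherwise the labels of \<open>I\<close> strictly
  between \<open>c'\<close> and \<open>c\<close> are exactly those of \<open>Z\<close>, so sorting
  \<open>c'\<close> into place costs the sign \<open>(- 1) ^ card Z\<close> already present in the
  matrix, and a positive multiple of the minor of \<open>I\<close> with \<open>c\<close> replaced by
  \<open>c'\<close> is added.\<close>

lemma positive_on_transversals_add_column:
  assumes pos: "positive_on_transversals k b V"
    and supp: "\<And>i x. i < k \<Longrightarrow> a i x \<noteq> 0 \<Longrightarrow> x \<in> U i"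
    and cc: "c' < c" and q: "0 < q"
    and col: "\<And>i. i < k \<Longrightarrow> a i c = b i c + (- 1) ^ card Z * q * b i c'"
    and cols: "\<And>i x. i < k \<Longrightarrow> x \<noteq> c \<Longrightarrow> a i x = b i x"
    and p: "p < k" "U p = insert c (V p)" "c' \<in> V p" "c \<notin> V p"
    and V: "\<And>i. i < k \<Longrightarrow> i \<noteq> p \<Longrightarrow> U i = V i"
    and exch: "\<And>i. i < k \<Longrightarrow> c' \<in> V i \<Longrightarrow> c \<in> U i"
    and Z: "Z \<subseteq> {c'<..<c}" "\<And>x. x \<in> Z \<Longrightarrow> \<exists>i<k. U i = {x}"
    and notZ: "\<And>x i. i < k \<Longrightarrow> c' < x \<Longrightarrow> x < c \<Longrightarrow> x \<in> U i \<Longrightarrow> x \<in> Z"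
  shows "positive_on_transversals k a U"
  unfolding positive_on_transversals_def
proof (intro allI impI, elim conjE)
  fix I :: "nat set" assume I: "finite I" "card I = k"
  have nonneg: "0 \<le> minor b I'" if "finite I'" "card I' = k" for I'
    using positive_on_transversals_nonneg[OF pos that] .
  have pos_b: "0 < minor b I'" if "finite I'" "card I' = k" "has_transversal k V I'" for I'
    using pos[unfolded positive_on_transversals_def, rule_format, of I'] that by simp
  have "0 < minor a I" if tr: "has_transversal k U I"
  proof -
    obtain \<phi> where \<phi>: "bij_betw \<phi> {..<k} I" "\<forall>i<k. \<phi> i \<in> U i"
      using tr by (auto simp: has_transversal_def)
    have \<phi>I: "\<phi> i \<in> I" if "i < k" for i using bij_betwE[OF \<phi>(1)] that by auto
    have onto: "\<exists>i<k. \<phi> i = x" if "x \<in> I" for x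
      using \<phi>(1) that by (auto simp: bij_betw_def)
    have trV: "has_transversal k V I" if "\<phi> p \<noteq> c"
      unfolding has_transversal_def using \<phi> p V that by (metis insert_iff)
    show ?thesis
    proof (cases "c \<in> I")
      case False
      then have "minor a I = minor b I" using I by (intro minor_cong cols) auto
      moreover have "\<phi> p \<noteq> c" using \<phi>I p(1) False by auto
      ultimately show ?thesis using pos_b I trV by simp
    next
      case True
      define J where "J = I - {c}"
      define xs where "xs = sorted_list_of_set J"
      define \<rho> where "\<rho> = card {x \<in> J. x < c}"
      have J: "finite J" "c \<notin> J" "insert c J = I" "card J + 1 = k"
        using I True card_gt_0_iff[of I] by (auto simp: J_def)
      have xs: "length xs < k" "set xs = J" using J by (auto simp: xs_def)
      have "column_det a (c # xs) =
          column_det b (c # xs) + (- 1) ^ card Z * q * column_det b (c' # xs)"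
      proof (rule column_det_add_column)
        show "a i c = b i c + (- 1) ^ card Z * q * b i c'" if "i \<le> length xs" for i
          using col that xs by simp
        show "a i x = b i x" if "i \<le> length xs" "x \<in> set xs" for i x
          by (rule cols) (use that xs J in auto)
      qed
      then have "(- 1) ^ \<rho> * minor a I =
          (- 1) ^ \<rho> * minor b I + (- 1) ^ card Z * q * column_det b (c' # xs)"
        using column_det_sorted_insert[OF J(1,2)] by (simp add: J(3) xs_def \<rho>_def)
      then have "(- 1) ^ \<rho> * ((- 1) ^ \<rho> * minor a I) = (- 1) ^ \<rho> *
          ((- 1) ^ \<rho> * minor b I + (- 1) ^ card Z * q * column_det b (c' # xs))"
        by simp
      then have minor_a: "minor a I =
          minor b I + (- 1) ^ \<rho> * (- 1) ^ card Z * q * column_det b (c' # xs)"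
        by (simp add: distrib_left flip: mult.assoc power_mult_distrib)
      show ?thesis
      proof (cases "c' \<in> I")
        case c': True
        then have "c' \<in> J" using cc by (simp add: J_def)
        then have "minor a I = minor b I"
          using minor_a column_det_repeated[of c' xs b] xs by simp
        moreover have "has_transversal k V I"
        proof (cases "\<phi> p = c")
          case True
          \<comment> \<open>Set \<open>i\<close> uses \<open>c'\<close> and set \<open>p\<close>
            uses the new label \<open>c\<close>. By \<open>exch\<close> the label \<open>c\<close>
            already lies in \<open>V i\<close>, and \<open>c'\<close> lies in \<open>V p\<close>, so
            the two can trade values.\<close>
          obtain i where i: "i < k" "\<phi> i = c'" using onto c' by auto
          have "i \<noteq> p" using i True cc by auto
          then have "c' \<in> V i" using \<phi>(2) i V by auto
          then have "c \<in> V i" using exch i V \<open>i \<noteq> p\<close> by auto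
          show ?thesis
            by (rule has_transversal_swap[OF \<phi>(1) p(1) i(1)])
              (use True i p \<open>c \<in> V i\<close> \<phi> V in auto)
        qed (rule trV)
        ultimately show ?thesis using pos_b I by simp
      next
        case c': False
        \<comment> \<open>Here \<open>I\<close> must be a transversal: a singleton
          \<open>U i\<close> forces its element into \<open>I\<close>, while a label of
          \<open>I\<close> in the gap lies in some set and so in \<open>Z\<close> by
          \<open>notZ\<close>.\<close>
        have mid: "{x \<in> J. c' < x \<and> x < c} = Z"
        proof (intro equalityI subsetI)
          fix x assume "x \<in> {x \<in> J. c' < x \<and> x < c}"
          moreover from this obtain i where "i < k" "\<phi> i = x" using onto J by auto
          ultimately show "x \<in> Z" using notZ \<phi>(2) by auto
        next
          fix x assume "x \<in> Z"
          then obtain i where i: "i < k" "U i = {x}" using Z(2) by auto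
          then have "\<phi> i = x" using \<phi>(2) by auto
          then have "x \<in> I" using \<phi>I i by auto
          then show "x \<in> {x \<in> J. c' < x \<and> x < c}" using Z(1) \<open>x \<in> Z\<close> by (auto simp: J_def)
        qed
        define I' where "I' = insert c' J"
        have "c' \<notin> J" using c' by (simp add: J_def)
        then have I': "finite I'" "card I' = k" using J by (auto simp: I'_def)
        have "{x \<in> J. x < c} = {x \<in> J. x < c'} \<union> Z"
          unfolding mid[symmetric] using cc \<open>c' \<notin> J\<close> by (auto, metis linorder_neqE_nat)
        then have "\<rho> = card ({x \<in> J. x < c'} \<union> Z)" by (simp add: \<rho>_def)
        also have "\<dots> = card {x \<in> J. x < c'} + card Z"
          using J(1) Z(1) by (intro card_Un_disjoint) (auto intro: finite_subset)
        finally have "(- 1) ^ \<rho> * (- 1) ^ card Z * q * column_det b (c' # xs) = q * minor b I'"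
          unfolding xs_def column_det_sorted_insert[OF J(1) \<open>c' \<notin> J\<close>] I'_def
          by (simp add: power_add)
        then have eq: "minor a I = minor b I + q * minor b I'" using minor_a by simp
        show ?thesis
        proof (cases "\<phi> p = c")
          case False
          then show ?thesis
            using eq pos_b[OF I trV] nonneg[OF I'] q by (simp add: add_pos_nonneg)
        next
          case True
          \<comment> \<open>Row \<open>p\<close> trades \<open>c\<close> for \<open>c'\<close>.
            Since \<open>I'\<close> does not contain \<open>c\<close>, its transversals for
            \<open>U\<close> are transversals for \<open>V\<close>, which makes the second summand
            positive.\<close>
          have "has_transversal k U (insert c' (I - {\<phi> p}))"
            by (rule has_transversal_exchange[OF \<phi> p(1)]) (use p c' in auto)
          then obtain \<psi> where \<psi>: "bij_betw \<psi> {..<k} I'"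
              "\<forall>i<k. \<psi> i \<in> U i"
            by (auto simp: has_transversal_def I'_def J_def True)
          have "\<psi> p \<noteq> c" using bij_betwE[OF \<psi>(1)] p(1) cc by (auto simp: I'_def J_def)
          then have "has_transversal k V I'"
            unfolding has_transversal_def using \<psi> p V by (metis insert_iff)
          then show ?thesis using eq pos_b[OF I'] nonneg[OF I] q by (simp add: add_nonneg_pos)
        qed
      qed
    qed
  qed
  moreover have "minor a I = 0" if "\<not> has_transversal k U I"
    using that minor_nonzero_transversal[OF I, of a U] supp by blast
  ultimately show "if has_transversal k U I then 0 < minor a I else minor a I = 0" by simp
qed

section \<open>Sources, sinks and signed path matrices\<close>

lemma initial_segment_eq:
  fixes S :: "nat set"
  assumes "finite S" "\<And>j. j \<in> S \<Longrightarrow> 1 \<le> j" "\<And>i j. j \<in> S \<Longrightarrow> 1 \<le> i \<Longrightarrow> i \<le> j \<Longrightarrow> i \<in> S"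
  shows "S = {1..card S}"
proof (cases "S = {}")
  case False
  have "S = {1..Max S}"
  proof (intro equalityI subsetI)
    show "j \<in> {1..Max S}" if "j \<in> S" for j
      using assms(2)[OF that] Max_ge[OF assms(1) that] by simp
    show "j \<in> S" if "j \<in> {1..Max S}" for j
      using assms(3)[OF Max_in[OF assms(1) False], of j] that by simp
  qed
  then show ?thesis by (metis card_atLeastAtMost diff_Suc_1)
qed simp

section \<open>Order of the boundary labels, and the signed matrix of a table of path
  weights\<close>

locale diagram_in_box =
  fixes k m :: nat and Y :: "(nat \<times> nat) set"
  assumes young: "young_diagram Y" and fits: "fits_in_box Y k m"
begin

abbreviation "src \<equiv> source_label m Y"
abbreviation "snk \<equiv> sink_label m Y"

lemma box: "(i, j) \<in> Y \<Longrightarrow> i \<in> {1..k} \<and> j \<in> {1..m}"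
  using fits by (auto simp: fits_in_box_def)

lemma young_down: "(i, j) \<in> Y \<Longrightarrow> 1 \<le> i' \<Longrightarrow> i' \<le> i \<Longrightarrow> 1 \<le> j' \<Longrightarrow> j' \<le> j \<Longrightarrow> (i', j') \<in> Y"
  using young unfolding young_diagram_def by (meson SigmaI atLeastAtMost_iff subsetD)

lemma in_row_iff: "(i, j) \<in> Y \<longleftrightarrow> 1 \<le> j \<and> j \<le> row_length Y i"
proof -
  have "{j. (i, j) \<in> Y} = {1..row_length Y i}"
    unfolding row_length_def
  proof (rule initial_segment_eq)
    show "finite {j. (i, j) \<in> Y}"
      by (rule finite_subset[of _ "{1..m}"]) (use box in auto)
  qed (use box young_down[of i _ i] in force)+
  then show ?thesis by (metis atLeastAtMost_iff mem_Collect_eq)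
qed

lemma in_col_iff: "(i, j) \<in> Y \<longleftrightarrow> 1 \<le> i \<and> i \<le> col_length Y j"
proof -
  have "{i. (i, j) \<in> Y} = {1..col_length Y j}"
    unfolding col_length_def
  proof (rule initial_segment_eq)
    show "finite {i. (i, j) \<in> Y}"
      by (rule finite_subset[of _ "{1..k}"]) (use box in auto)
  qed (use box young_down[of _ j _ j] in force)+
  then show ?thesis by (metis atLeastAtMost_iff mem_Collect_eq)
qed

lemma row_length_le: "row_length Y i \<le> m"
  using box[of i "row_length Y i"] in_row_iff[of i "row_length Y i"] by (cases "row_length Y i") auto

lemma col_length_le: "col_length Y j \<le> k"
  using box[of "col_length Y j" j] in_col_iff[of "col_length Y j" j] by (cases "col_length Y j") auto

lemma src_mono:
  assumes "1 \<le> i" "i < i'"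
  shows "src i < src i'"
proof -
  have "row_length Y i' \<le> row_length Y i"
    using assms in_row_iff[of i' "row_length Y i'"] in_row_iff[of i "row_length Y i'"]
      young_down[of i' "row_length Y i'" i "row_length Y i'"]
    by (cases "row_length Y i' = 0") auto
  then show ?thesis using assms by (simp add: source_label_def)
qed

lemma snk_antimono:
  assumes "1 \<le> j" "j < j'" "j' \<le> m"
  shows "snk j' < snk j"
proof -
  have "col_length Y j' \<le> col_length Y j"
    using assms in_col_iff[of "col_length Y j'" j'] in_col_iff[of "col_length Y j'" j]
      young_down[of "col_length Y j'" j' "col_length Y j'" j]
    by (cases "col_length Y j' = 0") auto
  then show ?thesis using assms by (simp add: sink_label_def)
qed

lemma src_less_iff: "i \<in> {1..k} \<Longrightarrow> i' \<in> {1..k} \<Longrightarrow> src i < src i' \<longleftrightarrow> i < i'"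
  using src_mono[of i i'] src_mono[of i' i] by (cases i i' rule: linorder_cases) auto

lemma src_eq_iff: "i \<in> {1..k} \<Longrightarrow> i' \<in> {1..k} \<Longrightarrow> src i = src i' \<longleftrightarrow> i = i'"
  using src_less_iff[of i i'] src_less_iff[of i' i] by (cases i i' rule: linorder_cases) auto

lemma snk_less_iff: "j \<in> {1..m} \<Longrightarrow> j' \<in> {1..m} \<Longrightarrow> snk j < snk j' \<longleftrightarrow> j' < j"
  using snk_antimono[of j j'] snk_antimono[of j' j] by (cases j j' rule: linorder_cases) auto

lemma snk_eq_iff: "j \<in> {1..m} \<Longrightarrow> j' \<in> {1..m} \<Longrightarrow> snk j = snk j' \<longleftrightarrow> j = j'"
  using snk_less_iff[of j j'] snk_less_iff[of j' j] by (cases j j' rule: linorder_cases) auto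

text \<open>The border passes the step of row \<open>i\<close> before the step of column
  \<open>j\<close> exactly when box \<open>(i, j)\<close> lies northwest of it. This lemma and the
  next are the two directions; together they turn all comparisons of a source with a sink into
  membership in \<open>Y\<close>.\<close>

lemma src_less_snk:
  assumes "(i, j) \<in> Y"
  shows "src i < snk j"
  using assms in_row_iff[of i j] in_col_iff[of i j] row_length_le[of i]
  by (auto simp: source_label_def sink_label_def)

lemma snk_less_src:
  assumes "i \<in> {1..k}" "j \<in> {1..m}" "(i, j) \<notin> Y"
  shows "snk j < src i"
  using assms in_row_iff[of i j] in_col_iff[of i j] row_length_le[of i]
  by (auto simp: source_label_def sink_label_def)

lemma src_less_snk_iff: "i \<in> {1..k} \<Longrightarrow> j \<in> {1..m} \<Longrightarrow> src i < snk j \<longleftrightarrow> (i, j) \<in> Y"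
  using src_less_snk snk_less_src by (meson less_asym)

lemma src_neq_snk: "i \<in> {1..k} \<Longrightarrow> j \<in> {1..m} \<Longrightarrow> src i \<noteq> snk j"
  using src_less_snk snk_less_src by (metis less_irrefl)

lemma src_in: "i \<in> {1..k} \<Longrightarrow> src i \<in> {1..k + m}"
  by (auto simp: source_label_def)

lemma snk_in: "j \<in> {1..m} \<Longrightarrow> snk j \<in> {1..k + m}"
  using col_length_le[of j] by (auto simp: sink_label_def)

text \<open>For a Sq-diagram this is a row of the support of the boundary measurement matrix,
  although paths may also move down: by \<open>sq_matrix_support\<close> no column is reached beyond
  those with a bullet in row \<open>i\<close>.\<close>

definition row_support :: "(nat \<times> nat) set \<Rightarrow> nat \<Rightarrow> nat set" where
  "row_support C i = insert (src i) (snk ` {l. (i, l) \<in> C})"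

definition label_sign :: "nat \<Rightarrow> nat \<Rightarrow> real" where
  "label_sign x y = (- 1) ^ card {s \<in> src ` {1..k}. min x y < s \<and> s < max x y}"

text \<open>Row \<open>i\<close> (starting at 0) belongs to row \<open>Suc i\<close> of the box, while columns are boundary labels
  and \<open>T\<close> is indexed by the rows and columns of the box.\<close>

definition signed_matrix :: "(nat \<Rightarrow> nat \<Rightarrow> real) \<Rightarrow> nat \<Rightarrow> nat \<Rightarrow> real" where
  "signed_matrix T i c =
     (if c \<in> src ` {1..k} then if c = src (Suc i) then 1 else 0
      else label_sign (src (Suc i)) c * (\<Sum>l | l \<in> {1..m} \<and> snk l = c. T (Suc i) l))"

lemma signed_matrix_src:
  "i < k \<Longrightarrow> r \<in> {1..k} \<Longrightarrow> signed_matrix T i (src r) = (if r = Suc i then 1 else 0)"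
  using src_eq_iff[of r "Suc i"] by (auto simp: signed_matrix_def)

text \<open>The sum in \<open>signed_matrix\<close> stands for an inverse of \<open>snk\<close>; by
  injectivity it has one term here.\<close>

lemma signed_matrix_snk:
  assumes "l \<in> {1..m}"
  shows "signed_matrix T i (snk l) = label_sign (src (Suc i)) (snk l) * T (Suc i) l"
proof -
  have "{l'. l' \<in> {1..m} \<and> snk l' = snk l} = {l}" using assms snk_eq_iff by blast
  moreover have "snk l \<notin> src ` {1..k}" using assms src_neq_snk by (metis imageE)
  ultimately show ?thesis by (simp add: signed_matrix_def)
qed

lemma signed_matrix_nonzero:
  assumes "signed_matrix T i c \<noteq> 0"
  shows "c = src (Suc i) \<or> (\<exists>l \<in> {1..m}. c = snk l \<and> T (Suc i) l \<noteq> 0)"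
  using assms by (auto simp: signed_matrix_def split: if_splits elim!: sum.not_neutral_contains_not_neutral)

lemma signed_matrix_cong:
  assumes "\<And>l. snk l = c \<Longrightarrow> T (Suc i) l = T' (Suc i) l"
  shows "signed_matrix T i c = signed_matrix T' i c"
proof -
  have "(\<Sum>l | l \<in> {1..m} \<and> snk l = c. T (Suc i) l) = (\<Sum>l | l \<in> {1..m} \<and> snk l = c. T' (Suc i) l)"
    using assms by (intro sum.cong) auto
  then show ?thesis by (simp add: signed_matrix_def)
qed

text \<open>Without bullets the only transversal is the set of sources. As \<open>src\<close> is
  increasing, sorting it lists the rows in order and the minor is that of the identity
  matrix.\<close>

lemma positive_on_transversals_identity:
  "positive_on_transversals k (signed_matrix (\<lambda>i l. 0)) (\<lambda>i. row_support {} (Suc i))"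
  unfolding positive_on_transversals_def
proof (intro allI impI, elim conjE)
  fix I :: "nat set" assume I: "finite I" "card I = k"
  let ?a = "signed_matrix (\<lambda>i l. 0)"
  have "0 < minor ?a I" if tr: "has_transversal k (\<lambda>i. row_support {} (Suc i)) I"
  proof -
    obtain \<phi> where \<phi>: "bij_betw \<phi> {..<k} I" "\<forall>i<k. \<phi> i = src (Suc i)"
      using tr by (auto simp: has_transversal_def row_support_def)
    have "I = \<phi> ` {..<k}" using \<phi>(1) by (simp add: bij_betw_def)
    also have "\<dots> = set (map (\<lambda>i. src (Suc i)) [0..<k])" using \<phi>(2) by auto
    finally have "I = set (map (\<lambda>i. src (Suc i)) [0..<k])" .
    moreover have "sorted (map (\<lambda>i. src (Suc i)) [0..<k])"
      by (auto simp: sorted_iff_nth_mono le_less intro: src_mono)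
    moreover have "distinct (map (\<lambda>i. src (Suc i)) [0..<k])"
      by (auto simp: distinct_map inj_on_def src_eq_iff)
    ultimately have "sorted_list_of_set I = map (\<lambda>i. src (Suc i)) [0..<k]"
      by (metis sorted_list_of_set.idem_if_sorted_distinct)
    then have "minor ?a I = det (mat k k (\<lambda>(i, t). ?a i (src (Suc t))))"
      unfolding minor_def column_det_def by (auto intro!: arg_cong[where f = det] eq_matI)
    also have "mat k k (\<lambda>(i, t). ?a i (src (Suc t))) = 1\<^sub>m k"
      by (intro eq_matI) (auto simp: signed_matrix_src)
    finally show ?thesis by simp
  qed
  moreover have "minor ?a I = 0" if "\<not> has_transversal k (\<lambda>i. row_support {} (Suc i)) I"
  proof (rule ccontr)
    assume "minor ?a I \<noteq> 0"
    then have "has_transversal k (\<lambda>i. row_support {} (Suc i)) I"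
      by (rule minor_nonzero_transversal[OF I])
        (use signed_matrix_nonzero in \<open>fastforce simp: row_support_def\<close>)
    then show False using that by simp
  qed
  ultimately show "if has_transversal k (\<lambda>i. row_support {} (Suc i)) I
      then 0 < minor ?a I else minor ?a I = 0" by simp
qed

end

text \<open>Row \<open>i\<close>, column \<open>l\<close> of the matrix is the weight of all paths from the source of row \<open>i\<close> to
  the lowest vertex of column \<open>l\<close>, when the bullets are added row by row from the top and from
  right to left in each row: the paths to a new bullet come from above or from the right.\<close>

inductive sq_matrix :: "(nat \<times> nat) set \<Rightarrow> (nat \<times> nat) set \<Rightarrow> (nat \<Rightarrow> nat \<Rightarrow> real) \<Rightarrow> bool"
  for Y where
  empty: "sq_matrix Y {} (\<lambda>i l. 0)"
| first_in_row: "sq_matrix Y C T \<Longrightarrow> sq_diagram Y (insert (r, j) C) \<Longrightarrow>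
    (\<And>i l. (i, l) \<in> C \<Longrightarrow> i < r) \<Longrightarrow> 0 < q \<Longrightarrow>
    sq_matrix Y (insert (r, j) C) (\<lambda>i l. if l = j then T i j + (if i = r then q else 0) else T i l)"
| next_in_row: "sq_matrix Y C T \<Longrightarrow> sq_diagram Y (insert (r, j) C) \<Longrightarrow> (r, j') \<in> C \<Longrightarrow> j < j' \<Longrightarrow>
    (\<And>i l. (i, l) \<in> C \<Longrightarrow> i < r \<or> i = r \<and> j' \<le> l) \<Longrightarrow> 0 < q \<Longrightarrow>
    sq_matrix Y (insert (r, j) C) (\<lambda>i l. if l = j then T i j + q * T i j' else T i l)"

lemma sq_diagram_le:
  "sq_diagram Y B \<Longrightarrow> i < i' \<Longrightarrow> j < j' \<Longrightarrow> (i', j') \<in> Y \<Longrightarrow> (i, j') \<in> B \<Longrightarrow> (i', j) \<in> B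
    \<Longrightarrow> (i', j') \<in> B"
  unfolding sq_diagram_def le_diagram_def by blast

lemma sq_diagram_sq:
  "sq_diagram Y B \<Longrightarrow> i < i' \<Longrightarrow> j < j' \<Longrightarrow> (i, j') \<in> B \<Longrightarrow> (i', j) \<in> B \<Longrightarrow> (i', j') \<in> B
    \<Longrightarrow> (i, j) \<in> B"
  unfolding sq_diagram_def by blast

lemma sq_diagram_subset: "sq_diagram Y B \<Longrightarrow> B \<subseteq> Y"
  by (simp add: sq_diagram_def le_diagram_def)

text \<open>All contributions are nonnegative, so nothing cancels. In the rule
  \<open>next_in_row\<close> a row \<open>i\<close> above \<open>r\<close> gains weight in column
  \<open>j\<close> only if \<open>(i, j')\<close> is a bullet, and then the Sq condition gives the
  bullet \<open>(i, j)\<close>: its entry was positive before.\<close>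

lemma sq_matrix_support:
  "sq_matrix Y C T \<Longrightarrow> if (i, l) \<in> C then 0 < T i l else T i l = 0"
proof (induction arbitrary: i l rule: sq_matrix.induct)
  case (first_in_row C T r j q)
  then show ?case
    using first_in_row.IH[of r j] by (force split: if_splits intro: add_pos_pos)
next
  case (next_in_row C T r j j' q)
  have "(i, j) \<in> C" if "(i, j') \<in> C" "i \<noteq> r"
    using sq_diagram_sq[OF next_in_row.hyps(2), of i r j j'] next_in_row.hyps that by force
  then show ?case
    using next_in_row.IH[of i l] next_in_row.IH[of i j'] next_in_row.hyps
    by (auto split: if_splits intro: add_pos_pos)
qed simp

section \<open>The induction step: one more bullet preserves positivity on transversals\<close>

context diagram_in_box
begin

text \<open>Treats both rules of \<open>sq_matrix\<close> at once: \<open>c'\<close> is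
  \<open>src r\<close> for the first bullet of a row and the sink of the next bullet to the right
  otherwise. The index \<open>r - 1\<close> appears because the sets are numbered from 0.\<close>

lemma positive_on_transversals_add_bullet:
  assumes pos: "positive_on_transversals k (signed_matrix T) (\<lambda>i. row_support C (Suc i))"
    and supp: "\<And>i l. (T' i l \<noteq> 0) = ((i, l) \<in> insert (r, j) C)"
    and sq: "sq_diagram Y (insert (r, j) C)" "(r, j) \<notin> C"
    and rows: "\<And>i l. (i, l) \<in> C \<Longrightarrow> i \<le> r"
    and c': "src r \<le> c'" "c' < snk j" "c' \<in> row_support C r"
    and gap: "\<And>l. (r, l) \<in> C \<Longrightarrow> snk l \<le> c'"
    and exch: "\<And>i. c' \<in> row_support C i \<Longrightarrow> i \<in> {1..k} \<Longrightarrow> i \<noteq> r \<Longrightarrow> (i, j) \<in> C"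
    and col: "\<And>i. i < k \<Longrightarrow> signed_matrix T' i (snk j) = signed_matrix T i (snk j) +
       (- 1) ^ card {s \<in> src ` {1..k}. c' < s \<and> s < snk j} * q * signed_matrix T i c'"
    and cols: "\<And>i l. l \<noteq> j \<Longrightarrow> T' i l = T i l"
    and q: "0 < q"
  shows "positive_on_transversals k (signed_matrix T') (\<lambda>i. row_support (insert (r, j) C) (Suc i))"
proof (rule positive_on_transversals_add_column[OF pos, where p = "r - 1"])
  have sub: "insert (r, j) C \<subseteq> Y" using sq_diagram_subset[OF sq(1)] .
  then have r: "r \<in> {1..k}" and j: "j \<in> {1..m}" using box by auto
  have CY: "(i, l) \<in> Y" "i \<in> {1..k}" "l \<in> {1..m}" if "(i, l) \<in> C" for i l
    using sub that box by blast+
  let ?Z = "{s \<in> src ` {1..k}. c' < s \<and> s < snk j}"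
  show "x \<in> row_support (insert (r, j) C) (Suc i)" if "i < k" "signed_matrix T' i x \<noteq> 0" for i x
    using signed_matrix_nonzero[OF that(2)] supp by (auto simp: row_support_def)
  show "c' < snk j" "0 < q" by fact+
  show "signed_matrix T' i (snk j) = signed_matrix T i (snk j) + (- 1) ^ card ?Z * q * signed_matrix T i c'"
    if "i < k" for i using col that .
  show "signed_matrix T' i x = signed_matrix T i x" if "i < k" "x \<noteq> snk j" for i x
    by (rule signed_matrix_cong, rule cols) (use that in auto)
  show "r - 1 < k" using r by auto
  show "row_support (insert (r, j) C) (Suc (r - 1)) = insert (snk j) (row_support C (Suc (r - 1)))"
    using r by (auto simp: row_support_def)
  show "c' \<in> row_support C (Suc (r - 1))" using c' r by simp
  show "snk j \<notin> row_support C (Suc (r - 1))"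
    using r j sq(2) src_neq_snk[OF r j] snk_eq_iff[OF j] CY(3) by (auto simp: row_support_def)
  show "row_support (insert (r, j) C) (Suc i) = row_support C (Suc i)" if "i < k" "i \<noteq> r - 1" for i
    using that by (auto simp: row_support_def)
  show "snk j \<in> row_support (insert (r, j) C) (Suc i)" if "i < k" "c' \<in> row_support C (Suc i)" for i
    using exch[OF that(2)] that(1) by (cases "Suc i = r") (auto simp: row_support_def)
  show "?Z \<subseteq> {c'<..<snk j}" by auto
  show "\<exists>i<k. row_support (insert (r, j) C) (Suc i) = {x}" if x: "x \<in> ?Z" for x
  proof -
    obtain i where i: "i \<in> {1..k}" "x = src i" "c' < src i" using x by auto
    \<comment> \<open>A source in the gap belongs to a row below \<open>r\<close>. Such rows have
      not received any bullet yet, so their support is the source alone.\<close>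
    then have "r < i" using c'(1) src_less_iff[OF r i(1)] by simp
    then have "row_support (insert (r, j) C) i = {x}"
      using i(2) rows by (force simp: row_support_def)
    then show ?thesis using i(1) by (intro exI[of _ "i - 1"]) auto
  qed
  show "x \<in> ?Z" if i: "i < k" and x: "c' < x" "x < snk j" "x \<in> row_support (insert (r, j) C) (Suc i)"
    for x i
  proof (rule ccontr)
    assume "x \<notin> ?Z"
    then have "x \<noteq> src (Suc i)" using i x by auto
    then obtain l where l: "x = snk l" "(Suc i, l) \<in> insert (r, j) C"
      using x by (auto simp: row_support_def)
    then have C: "(Suc i, l) \<in> C" using x by auto
    then have lm: "l \<in> {1..m}" and "Suc i \<le> r" using CY rows by auto
    have "j < l" using x l(1) snk_less_iff[OF lm j] by simp
    \<comment> \<open>A sink in the gap would come from a bullet in column \<open>l\<close> in row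
      \<open>r\<close> or above it, with \<open>j < l\<close>. Since \<open>snk l\<close> comes
      after \<open>src r\<close>, row \<open>r\<close> extends to column \<open>l\<close>, and the
      Le condition puts a bullet at \<open>(r, l)\<close>. This contradicts
      \<open>gap\<close>.\<close>
    have "(r, l) \<in> Y" using src_less_snk_iff[OF r lm] c'(1) x(1) l(1) by simp
    then have "(r, l) \<in> C"
      using sq_diagram_le[OF sq(1), of "Suc i" r j l] \<open>j < l\<close> \<open>Suc i \<le> r\<close> C
      by (cases "Suc i = r") auto
    then show False using gap x(1) l(1) by fastforce
  qed
qed

lemma sq_matrix_positive:
  "sq_matrix Y C T \<Longrightarrow> positive_on_transversals k (signed_matrix T) (\<lambda>i. row_support C (Suc i))"
proof (induction rule: sq_matrix.induct)
  case empty
  show ?case by (rule positive_on_transversals_identity)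
next
  case (first_in_row C T r j q)
  let ?T' = "\<lambda>i l. if l = j then T i j + (if i = r then q else 0) else T i l"
  have sub: "insert (r, j) C \<subseteq> Y" using sq_diagram_subset[OF first_in_row.hyps(2)] .
  then have rY: "(r, j) \<in> Y" and r: "r \<in> {1..k}" and j: "j \<in> {1..m}" using box by auto
  have col_in: "l \<in> {1..m}" if "(i, l) \<in> C" for i l using that sub box by blast
  have T': "sq_matrix Y (insert (r, j) C) ?T'"
    by (rule sq_matrix.first_in_row) (use first_in_row.hyps in auto)
  show ?case
  proof (rule positive_on_transversals_add_bullet[OF first_in_row.IH _ first_in_row.hyps(2),
        where c' = "src r" and q = q])
    show "(?T' i l \<noteq> 0) = ((i, l) \<in> insert (r, j) C)" for i l
      using sq_matrix_support[OF T', of i l] by (auto split: if_splits)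
    show "(r, j) \<notin> C" using first_in_row.hyps(3) by blast
    show "i \<le> r" if "(i, l) \<in> C" for i l using first_in_row.hyps(3)[OF that] by simp
    show "src r < snk j" using src_less_snk[OF rY] .
    show "src r \<in> row_support C r" by (simp add: row_support_def)
    show "snk l \<le> src r" if "(r, l) \<in> C" for l using first_in_row.hyps(3)[OF that] by simp
    \<comment> \<open>Vacuous: the label \<open>src r\<close> occurs in no other row
      support.\<close>
    show "(i, j) \<in> C" if h: "src r \<in> row_support C i" "i \<in> {1..k}" "i \<noteq> r" for i
    proof -
      have "src r \<noteq> src i" using src_eq_iff[OF r h(2)] h(3) by simp
      then obtain l where "src r = snk l" "(i, l) \<in> C" using h(1) by (auto simp: row_support_def)
      then show ?thesis using src_neq_snk[OF r col_in] by blast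
    qed
    show "signed_matrix ?T' i (snk j) = signed_matrix T i (snk j) +
       (- 1) ^ card {s \<in> src ` {1..k}. src r < s \<and> s < snk j} * q * signed_matrix T i (src r)"
      if "i < k" for i
      using that src_less_snk[OF rY]
      by (auto simp: signed_matrix_snk[OF j] signed_matrix_src[OF that r] label_sign_def algebra_simps)
  qed (use first_in_row.hyps in auto)
next
  case (next_in_row C T r j j' q)
  let ?T' = "\<lambda>i l. if l = j then T i j + q * T i j' else T i l"
  have sub: "insert (r, j) C \<subseteq> Y" using sq_diagram_subset[OF next_in_row.hyps(2)] .
  then have rY: "(r, j) \<in> Y" "(r, j') \<in> Y" and r: "r \<in> {1..k}" and j: "j \<in> {1..m}" "j' \<in> {1..m}"
    using box next_in_row.hyps(3) by auto
  have col_in: "l \<in> {1..m}" if "(i, l) \<in> C" for i l using that sub box by blast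
  have T': "sq_matrix Y (insert (r, j) C) ?T'"
    by (rule sq_matrix.next_in_row) (use next_in_row.hyps in auto)
  have snk: "snk j' < snk j" using next_in_row.hyps(4) j by (simp add: snk_less_iff)
  show ?case
  proof (rule positive_on_transversals_add_bullet[OF next_in_row.IH _ next_in_row.hyps(2),
        where c' = "snk j'" and q = q])
    show "(?T' i l \<noteq> 0) = ((i, l) \<in> insert (r, j) C)" for i l
      using sq_matrix_support[OF T', of i l] by (auto split: if_splits)
    show "(r, j) \<notin> C" using next_in_row.hyps(4,5) by fastforce
    show "i \<le> r" if "(i, l) \<in> C" for i l using next_in_row.hyps(5)[OF that] by auto
    show "src r \<le> snk j'" using src_less_snk[OF rY(2)] by simp
    show "snk j' < snk j" by fact
    show "snk j' \<in> row_support C r" using next_in_row.hyps(3) by (auto simp: row_support_def)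
    show "snk l \<le> snk j'" if "(r, l) \<in> C" for l
      using next_in_row.hyps(5)[OF that] snk_less_iff[OF j(2) col_in[OF that]] by (simp add: not_less[symmetric])
    show "(i, j) \<in> C" if h: "snk j' \<in> row_support C i" "i \<in> {1..k}" "i \<noteq> r" for i
    proof -
      obtain l where l: "snk j' = snk l" "(i, l) \<in> C"
        using h(1) src_neq_snk[OF h(2) j(2)] by (auto simp: row_support_def)
      then have "(i, j') \<in> C" using snk_eq_iff[OF j(2) col_in[OF l(2)]] by simp
      moreover from this have "i < r" using next_in_row.hyps(5) h(3) by blast
      \<comment> \<open>The Sq condition for rows \<open>i < r\<close> and columns
        \<open>j < j'\<close>, with the new bullet \<open>(r, j)\<close> as one of the three given
        corners.\<close>
      ultimately show ?thesis
        using sq_diagram_sq[OF next_in_row.hyps(2), of i r j j'] next_in_row.hyps(3,4) by auto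
    qed
    show "signed_matrix ?T' i (snk j) = signed_matrix T i (snk j) +
       (- 1) ^ card {s \<in> src ` {1..k}. snk j' < s \<and> s < snk j} * q * signed_matrix T i (snk j')"
      if "i < k" for i
    \<comment> \<open>The sources between \<open>src (Suc i)\<close> and \<open>snk j\<close> split
      at \<open>snk j'\<close> only if \<open>snk j'\<close> lies in between. A nonzero weight
      guarantees this, and the split turns the source counts into a product of signs.\<close>
    proof (cases "T (Suc i) j' = 0")
      case False
      let ?x = "src (Suc i)"
      have "(Suc i, j') \<in> C" using sq_matrix_support[OF next_in_row.hyps(1), of "Suc i" j'] False
        by (auto split: if_splits)
      then have x: "?x < snk j'" using sub by (intro src_less_snk) auto
      have cmp: "s < snk j' \<or> snk j' < s" if "s \<in> src ` {1..k}" for s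
        using that src_neq_snk[OF _ j(2)] by (metis imageE linorder_neqE_nat)
      have "{s \<in> src ` {1..k}. ?x < s \<and> s < snk j} =
          {s \<in> src ` {1..k}. ?x < s \<and> s < snk j'} \<union> {s \<in> src ` {1..k}. snk j' < s \<and> s < snk j}"
        using x snk cmp by fastforce
      then have "card {s \<in> src ` {1..k}. ?x < s \<and> s < snk j} =
          card {s \<in> src ` {1..k}. ?x < s \<and> s < snk j'} + card {s \<in> src ` {1..k}. snk j' < s \<and> s < snk j}"
        by (simp only:) (rule card_Un_disjoint; auto)
      then have "label_sign ?x (snk j) =
          (- 1) ^ card {s \<in> src ` {1..k}. snk j' < s \<and> s < snk j} * label_sign ?x (snk j')"
        using x snk by (simp add: label_sign_def power_add)
      then show ?thesis by (simp add: signed_matrix_snk[OF j(1)] signed_matrix_snk[OF j(2)] algebra_simps)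
    qed (simp add: signed_matrix_snk[OF j(1)] signed_matrix_snk[OF j(2)])
  qed (use next_in_row.hyps in auto)
qed

end

section \<open>Path weights in the network\<close>

definition path_weight ::
    "('a, 'b) pre_digraph \<Rightarrow> ('b \<Rightarrow> real) \<Rightarrow> 'a \<Rightarrow> 'a \<Rightarrow> real" where
  "path_weight G w u v = (\<Sum>P | pre_digraph.apath G u P v. prod_list (map w P))"

context fin_digraph
begin

lemma awalk_rank_le:
  fixes \<mu> :: "'a \<Rightarrow> nat"
  assumes "\<And>e. e \<in> arcs G \<Longrightarrow> \<mu> (tail G e) < \<mu> (head G e)"
    and "awalk x p y" "z \<in> set (awalk_verts x p)"
  shows "\<mu> z \<le> \<mu> y"
  using assms(2,3)
proof (induction p arbitrary: x z)
  case (Cons e es)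
  have es: "awalk (head G e) es y" "e \<in> arcs G" using Cons.prems(1) by (auto simp: awalk_Cons_iff)
  have "\<mu> (head G e) \<le> \<mu> y" by (rule Cons.IH[OF es(1)]) (rule hd_in_awalk_verts(1)[OF es(1)])
  then show ?case using assms(1)[OF es(2)] Cons.IH[OF es(1)] Cons.prems(2) by auto
qed (auto simp: awalk_Nil_iff)

lemma path_weight_self:
  assumes "u \<in> verts G"
  shows "path_weight G w u u = 1"
proof -
  have "{P. apath u P u} = {[]}"
    using assms apath_nonempty_ends[of u _ u] by (auto simp: apath_Nil_iff)
  then show ?thesis by (simp add: path_weight_def)
qed

text \<open>The rank ensures that appending an arc into \<open>v\<close> keeps a path free of
  repeated vertices: all vertices of a path ending at the tail of the arc have rank at most that of
  the tail, which is less than that of \<open>v\<close>.\<close>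

lemma path_weight_last_arc:
  fixes \<mu> :: "'a \<Rightarrow> nat"
  assumes rank: "\<And>e. e \<in> arcs G \<Longrightarrow> \<mu> (tail G e) < \<mu> (head G e)" and "u \<noteq> v"
  shows "path_weight G w u v = (\<Sum>e \<in> in_arcs G v. w e * path_weight G w u (tail G e))"
proof -
  have last: "apath u (P @ [e]) v \<longleftrightarrow> e \<in> in_arcs G v \<and> apath u P (tail G e)" for P e
  proof
    assume "apath u (P @ [e]) v"
    then show "e \<in> in_arcs G v \<and> apath u P (tail G e)"
      by (auto simp: apath_append_iff apath_Cons_iff apath_Nil_iff)
  next
    assume *: "e \<in> in_arcs G v \<and> apath u P (tail G e)"
    then have "awalk u P (tail G e)" by (simp add: apath_def)
    then have "awlast u P = tail G e" by auto
    moreover have "v \<notin> set (awalk_verts u P)"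
      using awalk_rank_le[of \<mu>, OF rank \<open>awalk u P (tail G e)\<close>] rank[of e] * by fastforce
    moreover have "tail G e \<noteq> v" using rank[of e] * by auto
    ultimately show "apath u (P @ [e]) v"
      using * by (auto simp: apath_append_iff apath_Cons_iff apath_Nil_iff)
  qed
  have "P \<noteq> []" if "apath u P v" for P using that assms(2) by (auto simp: apath_Nil_iff)
  then have "{P. apath u P v} = (\<Union>e \<in> in_arcs G v. (\<lambda>P. P @ [e]) ` {P. apath u P (tail G e)})"
    using last by (auto simp: image_iff) (metis append_butlast_last_id last)+
  then have "path_weight G w u v =
      (\<Sum>P \<in> (\<Union>e \<in> in_arcs G v. (\<lambda>P. P @ [e]) ` {P. apath u P (tail G e)}). prod_list (map w P))"
    by (simp add: path_weight_def)
  also have "\<dots> = (\<Sum>e \<in> in_arcs G v. \<Sum>P \<in> (\<lambda>P. P @ [e]) ` {P. apath u P (tail G e)}. prod_list (map w P))"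
    by (rule sum.UNION_disjoint) (auto intro: apaths_finite)
  also have "\<dots> = (\<Sum>e \<in> in_arcs G v. w e * path_weight G w u (tail G e))"
    by (intro sum.cong refl, subst sum.reindex)
      (auto simp: path_weight_def inj_on_def sum_distrib_left mult.commute)
  finally show ?thesis .
qed

end

lemma eq_Max_iff_maximal:
  fixes A :: "'a :: linorder set"
  assumes "finite A" "A \<noteq> {}"
  shows "x = Max A \<longleftrightarrow> x \<in> A \<and> (\<forall>y. x < y \<longrightarrow> y \<notin> A)"
  using Max_eq_iff[OF assms, of x] by (metis linorder_not_less)

lemma eq_Min_iff_minimal:
  fixes A :: "'a :: linorder set"
  assumes "finite A" "A \<noteq> {}"
  shows "x = Min A \<longleftrightarrow> x \<in> A \<and> (\<forall>y. y < x \<longrightarrow> y \<notin> A)"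
  using Min_eq_iff[OF assms, of x] by (metis linorder_not_less)

section \<open>The network of a Sq-diagram as a finite acyclic digraph, with \<open>k + m\<close>
  for \<open>n\<close>\<close>

locale sq_network = diagram_in_box k m Y for k m Y +
  fixes B :: "(nat \<times> nat) set" and w :: "net_vertex \<times> net_vertex \<Rightarrow> real"
  assumes sq: "sq_diagram Y B" and weights: "network_weighting k (k + m) Y B w"
begin

abbreviation "net \<equiv> network k (k + m) Y B"

lemma B_box: "(i, j) \<in> B \<Longrightarrow> i \<in> {1..k} \<and> j \<in> {1..m} \<and> (i, j) \<in> Y"
  using sq_diagram_subset[OF sq] box by blast

lemma finite_B: "finite B"
  by (rule finite_subset[of _ "{1..k} \<times> {1..m}"]) (use B_box in auto)

lemma sources_eq: "sources k (k + m) Y = src ` {1..k}"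
  by (simp add: sources_def)

lemma arcs_net: "arcs net = horizontal_arcs k (k + m) Y B \<union> vertical_arcs k (k + m) Y B"
  and tail_net: "tail net = fst" and head_net: "head net = snd"
  and verts_net: "verts net = Boundary ` {1..k + m} \<union> {Internal i j | i j. (i, j) \<in> B}"
  by (simp_all add: network_def)

lemma arcs_in_verts: "e \<in> arcs net \<Longrightarrow> fst e \<in> verts net \<and> snd e \<in> verts net"
  using B_box src_in snk_in
  by (auto simp: arcs_net verts_net horizontal_arcs_def vertical_arcs_def)

sublocale net: fin_digraph net
proof
  have "verts net = Boundary ` {1..k + m} \<union> (\<lambda>(i, j). Internal i j) ` B"
    by (auto simp: verts_net)
  then show fin: "finite (verts net)" using finite_B by simp
  show "finite (arcs net)"
    by (rule finite_subset[OF _ finite_cartesian_product[OF fin fin]])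
      (use arcs_in_verts in \<open>auto simp: mem_Times_iff\<close>)
qed (use arcs_in_verts in \<open>auto simp: tail_net head_net\<close>)

text \<open>Arcs between bullets go left or down, so \<open>i + (m - j)\<close> increases along
  them. The summand 1 lifts bullets above the sources, and as \<open>i \<le> k\<close> and
  \<open>1 \<le> j\<close> their rank is at most \<open>k + m\<close>, below that of the
  sinks.\<close>

fun vertex_rank :: "net_vertex \<Rightarrow> nat" where
  "vertex_rank (Boundary c) = (if c \<in> src ` {1..k} then 0 else k + m + 2)"
| "vertex_rank (Internal i j) = 1 + i + (m - j)"

lemma snk_not_source: "j \<in> {1..m} \<Longrightarrow> snk j \<notin> src ` {1..k}"
  using src_neq_snk by (metis imageE)

lemma vertex_rank_less: "e \<in> arcs net \<Longrightarrow> vertex_rank (tail net e) < vertex_rank (head net e)"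
proof -
  assume "e \<in> arcs net"
  then consider i j where "e = (Boundary (src i), Internal i j)" "i \<in> {1..k}"
    | i j j' where "e = (Internal i j, Internal i j')" "j' < j" "(i, j) \<in> B"
    | i i' j where "e = (Internal i j, Internal i' j)" "i < i'"
    | i j where "e = (Internal i j, Boundary (snk j))" "(i, j) \<in> B"
    unfolding arcs_net horizontal_arcs_def vertical_arcs_def by auto
  then show ?thesis
  proof cases
    case (2 i j j')
    then show ?thesis using B_box[OF 2(3)] by (auto simp: tail_net head_net)
  next
    case (4 i j)
    then show ?thesis using B_box[OF 4(2)] snk_not_source[of j] by (auto simp: tail_net head_net)
  qed (auto simp: tail_net head_net)
qed

lemmas path_weight_step = net.path_weight_last_arc[of vertex_rank, OF vertex_rank_less]

abbreviation pw :: "nat \<Rightarrow> net_vertex \<Rightarrow> real" where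
  "pw i v \<equiv> path_weight net w (Boundary (src i)) v"

abbreviation above :: "nat \<Rightarrow> nat \<Rightarrow> nat set" where
  "above r j \<equiv> {r'. r' < r \<and> (r', j) \<in> B}"

abbreviation right :: "nat \<Rightarrow> nat \<Rightarrow> nat set" where
  "right r j \<equiv> {j'. j < j' \<and> (r, j') \<in> B}"

lemma finite_column: "finite {r. (r, j) \<in> B}" and finite_row: "finite {j. (r, j) \<in> B}"
  by (rule finite_subset[of _ "{1..k}"]; use B_box in auto)
     (rule finite_subset[of _ "{1..m}"]; use B_box in auto)

lemma finite_above: "finite (above r j)" and finite_right: "finite (right r j)"
  using finite_column[of j] finite_row[of r] by (auto elim: rev_finite_subset)

lemma next_above_iff:
  assumes "above r j \<noteq> {}"
  shows "r' < r \<and> (r', j) \<in> B \<and> (\<forall>l. r' < l \<and> l < r \<longrightarrow> (l, j) \<notin> B) \<longleftrightarrow> r' = Max (above r j)"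
  unfolding eq_Max_iff_maximal[OF finite_above assms] by blast

lemma next_right_iff:
  assumes "right r j \<noteq> {}"
  shows "j < j' \<and> (r, j') \<in> B \<and> (\<forall>l. j < l \<and> l < j' \<longrightarrow> (r, l) \<notin> B) \<longleftrightarrow> j' = Min (right r j)"
  unfolding eq_Min_iff_minimal[OF finite_right assms] by blast

lemma in_arcs_internal:
  assumes "(r, j) \<in> B"
  shows "in_arcs net (Internal r j) =
     (if above r j = {} then {} else {(Internal (Max (above r j)) j, Internal r j)}) \<union>
     {(if right r j = {} then Boundary (src r) else Internal r (Min (right r j)), Internal r j)}"
proof -
  \<comment> \<open>The dummy variable \<open>u\<close> yields a set that is a singleton or empty
    according to the condition, parallel to the other two comprehensions.\<close>
  have "in_arcs net (Internal r j) =
      {(Internal r' j, Internal r j) | r'. r' < r \<and> (r', j) \<in> B \<and> (\<forall>l. r' < l \<and> l < r \<longrightarrow> (l, j) \<notin> B)} \<union>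
      ({(Boundary (src r), Internal r j) | u :: unit. right r j = {}} \<union>
       {(Internal r j', Internal r j) | j'. j < j' \<and> (r, j') \<in> B \<and> (\<forall>l. j < l \<and> l < j' \<longrightarrow> (r, l) \<notin> B)})"
    using assms B_box[OF assms]
    by (auto simp: in_arcs_def arcs_net head_net horizontal_arcs_def vertical_arcs_def)
  also have "{(Internal r' j, Internal r j) | r'. r' < r \<and> (r', j) \<in> B \<and> (\<forall>l. r' < l \<and> l < r \<longrightarrow> (l, j) \<notin> B)}
      = (if above r j = {} then {} else {(Internal (Max (above r j)) j, Internal r j)})"
    by (cases "above r j = {}") (use next_above_iff[of r j] in auto)
  also have "{(Boundary (src r), Internal r j) | u :: unit. right r j = {}} \<union>
       {(Internal r j', Internal r j) | j'. j < j' \<and> (r, j') \<in> B \<and> (\<forall>l. j < l \<and> l < j' \<longrightarrow> (r, l) \<notin> B)}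
      = {(if right r j = {} then Boundary (src r) else Internal r (Min (right r j)), Internal r j)}"
    by (cases "right r j = {}") (use next_right_iff[of j r] in auto)
  finally show ?thesis .
qed

lemma in_arcs_snk:
  assumes "l \<in> {1..m}"
  shows "in_arcs net (Boundary (snk l)) =
    (if {r. (r, l) \<in> B} = {} then {} else {(Internal (Max {r. (r, l) \<in> B}) l, Boundary (snk l))})"
proof -
  have "in_arcs net (Boundary (snk l)) =
      {(Internal i l, Boundary (snk l)) | i. (i, l) \<in> B \<and> (\<forall>i'>i. (i', l) \<notin> B)}"
  proof -
    have "j = l" if "(i, j) \<in> B" "snk j = snk l" for i j
      using snk_eq_iff[of j l] B_box[OF that(1)] that(2) assms by blast
    then show ?thesis
      by (auto simp: in_arcs_def arcs_net head_net horizontal_arcs_def vertical_arcs_def) blast+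
  qed
  moreover have "(i, l) \<in> B \<and> (\<forall>i'>i. (i', l) \<notin> B) \<longleftrightarrow> i = Max {r. (r, l) \<in> B}"
    if "{r. (r, l) \<in> B} \<noteq> {}" for i
    unfolding eq_Max_iff_maximal[OF finite_column that] by blast
  ultimately show ?thesis by auto
qed

lemma in_arcs_boundary_empty:
  assumes "c \<notin> snk ` {1..m}"
  shows "in_arcs net (Boundary c) = {}"
  using assms B_box
  by (auto simp: in_arcs_def arcs_net head_net horizontal_arcs_def vertical_arcs_def)

lemma pw_boundary:
  assumes "i \<in> {1..k}" "c \<notin> snk ` {1..m}"
  shows "pw i (Boundary c) = (if c = src i then 1 else 0)"
proof (cases "c = src i")
  case True
  have "Boundary (src i) \<in> verts net" using src_in[OF assms(1)] by (auto simp: verts_net)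
  then show ?thesis using True net.path_weight_self by simp
next
  case False
  then have "pw i (Boundary c) = (\<Sum>e \<in> in_arcs net (Boundary c). w e * pw i (tail net e))"
    by (intro path_weight_step) auto
  then show ?thesis using False in_arcs_boundary_empty[OF assms(2)] by simp
qed

lemma weight_horizontal_pos: "e \<in> horizontal_arcs k (k + m) Y B \<Longrightarrow> 0 < w e"
  and weight_vertical: "e \<in> vertical_arcs k (k + m) Y B \<Longrightarrow> w e = 1"
  using weights by (auto simp: network_weighting_def)

text \<open>Only the end vertex depends on \<open>C\<close>; the paths are those of the full
  network. The value 0 for a column without bullets agrees with the initial matrix of
  \<open>sq_matrix\<close>.\<close>

definition column_end :: "(nat \<times> nat) set \<Rightarrow> nat \<Rightarrow> nat \<Rightarrow> real" where
  "column_end C i l = (if {r. (r, l) \<in> C} = {} then 0 else pw i (Internal (Max {r. (r, l) \<in> C}) l))"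

text \<open>The only arc into the sink of a nonempty column comes from its lowest bullet and has
  weight 1.\<close>

lemma pw_snk:
  assumes "i \<in> {1..k}" "l \<in> {1..m}"
  shows "pw i (Boundary (snk l)) = column_end B i l"
proof -
  have "pw i (Boundary (snk l)) =
      (\<Sum>e \<in> in_arcs net (Boundary (snk l)). w e * pw i (tail net e))"
    using src_neq_snk[OF assms] by (intro path_weight_step) auto
  moreover have "w e = 1" if "e \<in> in_arcs net (Boundary (snk l))" for e
    using that by (intro weight_vertical)
      (auto simp: in_arcs_def arcs_net head_net horizontal_arcs_def)
  ultimately show ?thesis
    using in_arcs_snk[OF assms(2)] by (simp add: column_end_def tail_net)
qed

text \<open>The constant \<open>q\<close> of both rules of \<open>sq_matrix\<close>.\<close>

definition entering_weight :: "nat \<Rightarrow> nat \<Rightarrow> real" where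
  "entering_weight r j =
     w (if right r j = {} then Boundary (src r) else Internal r (Min (right r j)), Internal r j)"

lemma entering_arc:
  assumes "(r, j) \<in> B"
  shows "(if right r j = {} then Boundary (src r) else Internal r (Min (right r j)), Internal r j)
    \<in> horizontal_arcs k (k + m) Y B"
proof (cases "right r j = {}")
  case True
  then show ?thesis using assms B_box[OF assms] by (auto simp: horizontal_arcs_def)
next
  case False
  define j' where "j' = Min (right r j)"
  then have "j < j' \<and> (r, j') \<in> B \<and> (\<forall>l. j < l \<and> l < j' \<longrightarrow> (r, l) \<notin> B)"
    using next_right_iff[OF False] by blast
  then have "(Internal r j', Internal r j) \<in> horizontal_arcs k (k + m) Y B"
    unfolding horizontal_arcs_def using assms by blast
  then show ?thesis using False by (simp only: j'_def if_False)
qed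

lemma above_arc:
  assumes "(r, j) \<in> B" "above r j \<noteq> {}"
  shows "(Internal (Max (above r j)) j, Internal r j) \<in> vertical_arcs k (k + m) Y B"
proof -
  define r' where "r' = Max (above r j)"
  then have "r' < r \<and> (r', j) \<in> B \<and> (\<forall>l. r' < l \<and> l < r \<longrightarrow> (l, j) \<notin> B)"
    using next_above_iff[OF assms(2)] by blast
  then have "(Internal r' j, Internal r j) \<in> vertical_arcs k (k + m) Y B"
    unfolding vertical_arcs_def using assms(1) by blast
  then show ?thesis by (simp only: r'_def)
qed

lemma entering_weight_pos: "(r, j) \<in> B \<Longrightarrow> 0 < entering_weight r j"
  unfolding entering_weight_def by (intro weight_horizontal_pos entering_arc)

text \<open>The recursion over the last arc at a bullet: at most one arc from above, of weight 1,
  and exactly one from the right. The two cases of the second summand become the two rules of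
  \<open>sq_matrix\<close>.\<close>

lemma pw_internal:
  assumes i: "i \<in> {1..k}" and B: "(r, j) \<in> B"
  shows "pw i (Internal r j) = (if above r j = {} then 0 else pw i (Internal (Max (above r j)) j)) +
     (if right r j = {} then if i = r then entering_weight r j else 0
      else entering_weight r j * pw i (Internal r (Min (right r j))))"
proof -
  define e where
    "e = (if right r j = {} then Boundary (src r) else Internal r (Min (right r j)), Internal r j)"
  have r: "r \<in> {1..k}" using B_box[OF B] by simp
  have "pw i (Internal r j) = (\<Sum>e \<in> in_arcs net (Internal r j). w e * pw i (tail net e))"
    by (intro path_weight_step) auto
  also have "\<dots> = (if above r j = {} then 0 else pw i (Internal (Max (above r j)) j)) +
      w e * pw i (fst e)"
  proof (cases "above r j = {}")
    case True
    have "in_arcs net (Internal r j) = {e}"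
      unfolding in_arcs_internal[OF B] e_def if_P[OF True] by (rule Un_empty_left)
    then show ?thesis using True by (simp add: tail_net)
  next
    case False
    define r' where "r' = Max (above r j)"
    define a where "a = (Internal r' j, Internal r j)"
    have "in_arcs net (Internal r j) = {a, e}"
      unfolding in_arcs_internal[OF B] a_def e_def if_not_P[OF False] r'_def
      by (simp only: Un_insert_left Un_empty_left)
    moreover have "a \<noteq> e"
    proof -
      have "r' < r" using next_above_iff[OF False] r'_def by blast
      then show ?thesis by (auto simp: a_def e_def simp del: Collect_empty_eq)
    qed
    moreover have "w a = 1"
      unfolding a_def r'_def by (rule weight_vertical[OF above_arc[OF B False]])
    ultimately show ?thesis unfolding if_not_P[OF False] r'_def[symmetric] by (simp add: tail_net a_def)
  qed
  also have "w e * pw i (fst e) = (if right r j = {} then if i = r then entering_weight r j else 0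
      else entering_weight r j * pw i (Internal r (Min (right r j))))"
  proof (cases "right r j = {}")
    case True
    have "src r \<notin> snk ` {1..m}" using src_neq_snk[OF r] by blast
    then have "pw i (fst e) = (if i = r then 1 else 0)"
      using True pw_boundary[OF i] src_eq_iff[OF i r] by (auto simp: e_def)
    then show ?thesis using True by (simp add: entering_weight_def e_def)
  next
    case False
    show ?thesis unfolding e_def entering_weight_def if_not_P[OF False] fst_conv ..
  qed
  finally show ?thesis .
qed

section \<open>From path weights to the bullet-by-bullet recursion\<close>

definition reading_prefix :: "(nat \<times> nat) set \<Rightarrow> bool" where
  "reading_prefix C \<longleftrightarrow> C \<subseteq> B \<and>
     (\<forall>i l r j. (r, j) \<in> C \<and> (i, l) \<in> B \<and> (i < r \<or> i = r \<and> j \<le> l) \<longrightarrow> (i, l) \<in> C)"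

text \<open>The bullet forced by Le lies to the right of \<open>(i', j)\<close> in its row, the one
  forced by Sq lies in a higher row. Both precede \<open>(i', j)\<close> in the reading order, so a
  prefix contains them.\<close>

lemma reading_prefix_sq:
  assumes "reading_prefix C"
  shows "sq_diagram Y C"
proof -
  have CB: "C \<subseteq> B" and pre: "\<And>i l r j. (r, j) \<in> C \<Longrightarrow> (i, l) \<in> B \<Longrightarrow> i < r \<or> i = r \<and> j \<le> l \<Longrightarrow> (i, l) \<in> C"
    using assms unfolding reading_prefix_def by blast+
  show ?thesis
    unfolding sq_diagram_def le_diagram_def
  proof (intro conjI allI impI)
    show "young_diagram Y" by (rule young)
    show "C \<subseteq> Y" using CB sq_diagram_subset[OF sq] by (rule order_trans)
    show "(i', j') \<in> C"
      if "i < i' \<and> j < j' \<and> (i', j') \<in> Y \<and> (i, j') \<in> C \<and> (i', j) \<in> C" for i i' j j'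
      using pre[of i' j i' j'] sq_diagram_le[OF sq, of i i' j j'] that CB by auto
    show "(i, j) \<in> C"
      if "i < i' \<and> j < j' \<and> (i, j') \<in> C \<and> (i', j) \<in> C \<and> (i', j') \<in> C" for i i' j j'
      using pre[of i' j i j] sq_diagram_sq[OF sq, of i i' j j'] that CB by auto
  qed
qed

lemma reading_prefix_matrix:
  "reading_prefix C \<Longrightarrow> \<exists>T. sq_matrix Y C T \<and> (\<forall>i \<in> {1..k}. \<forall>l. T i l = column_end C i l)"
proof (induction "card C" arbitrary: C rule: less_induct)
  case less
  have CB: "C \<subseteq> B" and pre: "\<And>i l r j. (r, j) \<in> C \<Longrightarrow> (i, l) \<in> B \<Longrightarrow> i < r \<or> i = r \<and> j \<le> l \<Longrightarrow> (i, l) \<in> C"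
    using less.prems unfolding reading_prefix_def by blast+
  have fin: "finite C" using finite_subset[OF CB finite_B] .
  show ?case
  proof (cases "C = {}")
    case True
    then show ?thesis using sq_matrix.empty[of Y] by (auto simp: column_end_def)
  next
    case False
    \<comment> \<open>\<open>(r, j)\<close> will be the last bullet of \<open>C\<close>: the lowest
      row, and its leftmost bullet because rows are read from right to left.\<close>
    define r where "r = Max (fst ` C)"
    define j where "j = Min {l. (r, l) \<in> C}"
    have r1: "r \<in> fst ` C" using Max_in[of "fst ` C"] False fin by (simp add: r_def)
    have r2: "i \<le> r" if "(i, l) \<in> C" for i l
      using Max_ge[of "fst ` C" i] fin imageI[OF that, of fst] by (simp add: r_def)
    have row: "finite {l. (r, l) \<in> C}" "{l. (r, l) \<in> C} \<noteq> {}"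
      using finite_row[of r] CB r1 by (auto elim!: rev_finite_subset)
    have j: "(r, j) \<in> C" "\<And>l. (r, l) \<in> C \<Longrightarrow> j \<le> l"
      using Min_in[OF row] Min_le[OF row(1)] by (auto simp: j_def)
    define C' where "C' = C - {(r, j)}"
    have C: "C = insert (r, j) C'" "(r, j) \<notin> C'" using j(1) by (auto simp: C'_def)
    have rjB: "(r, j) \<in> B" using j(1) CB by auto
    have "reading_prefix C'"
      unfolding reading_prefix_def
    proof (intro conjI allI impI)
      show "(i, l) \<in> C'" if "(r', j') \<in> C' \<and> (i, l) \<in> B \<and> (i < r' \<or> i = r' \<and> j' \<le> l)" for i l r' j'
      proof -
        have "(i, l) \<in> C" using pre[of r' j' i l] that by (auto simp: C'_def)
        moreover have "(i, l) \<noteq> (r, j)" using that r2[of r' j'] j(2)[of j'] by (auto simp: C'_def)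
        ultimately show ?thesis by (auto simp: C'_def)
      qed
    qed (use CB in \<open>auto simp: C'_def\<close>)
    moreover have "card C' < card C" using card_Diff1_less[OF fin j(1)] by (simp only: C'_def)
    ultimately obtain T where T: "sq_matrix Y C' T" "\<forall>i \<in> {1..k}. \<forall>l. T i l = column_end C' i l"
      using less.hyps by blast
    have sqC: "sq_diagram Y (insert (r, j) C')" using reading_prefix_sq[OF less.prems] C(1) by simp
    \<comment> \<open>The neighbours of \<open>(r, j)\<close> above and to the right in the whole of
      \<open>B\<close> already belong to \<open>C'\<close>; this is what lets weights of the full
      network satisfy the recursion of the prefix.\<close>
    have above: "above r j = {r'. (r', j) \<in> C'}"
    proof (intro equalityI subsetI)
      show "r' \<in> {r'. (r', j) \<in> C'}" if "r' \<in> above r j" for r'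
        using that pre[OF j(1), of r' j] by (auto simp: C'_def)
      show "r' \<in> above r j" if "r' \<in> {r'. (r', j) \<in> C'}" for r'
        using that r2[of r' j] CB by (auto simp: C'_def intro: le_neq_implies_less)
    qed
    have right: "right r j = {l. (r, l) \<in> C'}"
    proof (intro equalityI subsetI)
      show "l \<in> {l. (r, l) \<in> C'}" if "l \<in> right r j" for l
        using that pre[OF j(1), of r l] by (auto simp: C'_def)
      show "l \<in> right r j" if "l \<in> {l. (r, l) \<in> C'}" for l
        using that j(2)[of l] CB by (auto simp: C'_def intro: le_neq_implies_less)
    qed
    have col_other: "column_end C i l = column_end C' i l" if "l \<noteq> j" for i l
      using that by (simp add: column_end_def C(1))
    have "{r'. (r', j) \<in> C} = insert r (above r j)" using above by (auto simp: C(1))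
    moreover have "Max (insert r (above r j)) = r" using finite_above by (intro Max_eqI) auto
    ultimately have col_j: "column_end C i j = pw i (Internal r j)" for i by (simp add: column_end_def)
    have up: "(if above r j = {} then 0 else pw i (Internal (Max (above r j)) j)) = column_end C' i j" for i
      by (simp add: column_end_def above)
    show ?thesis
    proof (cases "right r j = {}")
      case True
      have "i < r" if "(i, l) \<in> C'" for i l
        using r2[of i l] that True right by (auto simp: C(1) le_less)
      then have mat: "sq_matrix Y (insert (r, j) C')
          (\<lambda>i l. if l = j then T i j + (if i = r then entering_weight r j else 0) else T i l)"
        by (intro sq_matrix.first_in_row T sqC entering_weight_pos rjB)
      have "column_end C i j = T i j + (if i = r then entering_weight r j else 0)"
        if "i \<in> {1..k}" for i
        unfolding col_j pw_internal[OF that rjB] up if_P[OF True] using T(2) that by simp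
      then show ?thesis
        using T(2) col_other mat C(1) by (intro exI[of _ "\<lambda>i l. if l = j then T i j +
          (if i = r then entering_weight r j else 0) else T i l"]) simp
    next
      case False
      define j' where "j' = Min (right r j)"
      have "j' \<in> right r j" unfolding j'_def by (rule Min_in[OF finite_right False])
      then have j': "j < j'" "(r, j') \<in> C'" using right by blast+
      have j'_le: "j' \<le> l" if "(r, l) \<in> C'" for l
        unfolding j'_def by (rule Min_le[OF finite_right]) (use that right in blast)
      have mat: "sq_matrix Y (insert (r, j) C')
          (\<lambda>i l. if l = j then T i j + entering_weight r j * T i j' else T i l)"
      proof (rule sq_matrix.next_in_row[OF T(1) sqC j'(2,1) _ entering_weight_pos[OF rjB]])
        show "i < r \<or> i = r \<and> j' \<le> l" if "(i, l) \<in> C'" for i l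
        proof (cases "i = r")
          case True
          then show ?thesis using that j'_le by blast
        next
          case False
          then show ?thesis using r2[of i l] that by (simp add: C(1))
        qed
      qed
      have "column_end C i j = T i j + entering_weight r j * T i j'" if "i \<in> {1..k}" for i
      proof -
        \<comment> \<open>No row of \<open>C'\<close> lies below \<open>r\<close>, so column
          \<open>j'\<close> ends at the right neighbour of the new bullet.\<close>
        have "Max {r'. (r', j') \<in> C'} = r"
        proof (rule Max_eqI)
          show "finite {r'. (r', j') \<in> C'}"
            by (rule finite_subset[OF _ finite_column[of j']]) (use CB in \<open>auto simp: C'_def\<close>)
          show "i \<le> r" if "i \<in> {r'. (r', j') \<in> C'}" for i
            using that r2[of i j'] by (simp add: C(1))
        qed (use j'(2) in simp)
        then have "column_end C' i j' = pw i (Internal r j')"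
          using j'(2) by (auto simp: column_end_def)
        then show ?thesis
          unfolding col_j pw_internal[OF that rjB] up if_not_P[OF False] j'_def[symmetric]
          using T(2) that by simp
      qed
      then show ?thesis
        using T(2) col_other mat C(1) by (intro exI[of _ "\<lambda>i l. if l = j then T i j +
          entering_weight r j * T i j' else T i l"]) simp
    qed
  qed
qed

lemma label_sign_same: "label_sign x x = 1"
proof -
  have "{s \<in> src ` {1..k}. min x x < s \<and> s < max x x} = {}" by auto
  then show ?thesis by (simp only: label_sign_def card.empty power_0)
qed

lemma meas_entry_sq_matrix:
  obtains T where "sq_matrix Y B T"
    "\<And>i c. i < k \<Longrightarrow> meas_entry k (k + m) Y B w (src (Suc i)) c = signed_matrix T i c"
proof -
  have "reading_prefix B" by (auto simp: reading_prefix_def)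
  then obtain T where T: "sq_matrix Y B T" "\<forall>i \<in> {1..k}. \<forall>l. T i l = column_end B i l"
    using reading_prefix_matrix by blast
  have "meas_entry k (k + m) Y B w (src (Suc i)) c = signed_matrix T i c" if "i < k" for i c
  proof -
    have i: "Suc i \<in> {1..k}" using that by simp
    have meas: "meas_entry k (k + m) Y B w (src (Suc i)) c =
        label_sign (src (Suc i)) c * pw (Suc i) (Boundary c)"
      by (simp add: meas_entry_def path_weight_def label_sign_def sources_eq sum_distrib_left)
    \<comment> \<open>The label \<open>c\<close> is arbitrary; in the third case both sides are
      0.\<close>
    consider r where "r \<in> {1..k}" "c = src r" | l where "l \<in> {1..m}" "c = snk l"
      | "c \<notin> src ` {1..k}" "c \<notin> snk ` {1..m}" by blast
    then show ?thesis
    proof cases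
      case 1
      then have "src r \<notin> snk ` {1..m}" using src_neq_snk by blast
      then show ?thesis
        using 1 meas pw_boundary[OF i, of c] signed_matrix_src[OF that 1(1), of T] src_eq_iff[OF 1(1) i]
        by (simp add: label_sign_same)
    next
      case 2
      then show ?thesis
        using meas pw_snk[OF i 2(1)] signed_matrix_snk[OF 2(1)] T(2) i by simp
    next
      case 3
      then have "signed_matrix T i c = 0" using signed_matrix_nonzero[of T i c] i by blast
      moreover have "c \<noteq> src (Suc i)" using 3 i by blast
      ultimately show ?thesis using 3 meas pw_boundary[OF i 3(2)] by simp
    qed
  qed
  then show thesis using T(1) that by blast
qed

end

section \<open>Matroids, minimality and crossings\<close>

text \<open>If every exchange failed, the cofactor vector of the list \<open>I - {x}\<close> would
  be orthogonal to all columns of \<open>J\<close>: a column shared with \<open>I\<close> is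
  repeated, any other would give a vanishing minor. These columns are independent, so the vector is
  zero, and expanding the minor of \<open>I\<close> along \<open>x\<close> gives 0.\<close>

lemma minor_exchange:
  assumes I: "finite I" "card I = k" "minor a I \<noteq> 0"
    and J: "finite J" "card J = k" "minor a J \<noteq> 0"
    and x: "x \<in> I - J"
  shows "\<exists>y \<in> J - I. minor a (insert y (I - {x})) \<noteq> 0"
proof (rule ccontr)
  assume no: "\<not> ?thesis"
  define xs where "xs = sorted_list_of_set (I - {x})"
  define zs where "zs = sorted_list_of_set J"
  have "0 < k" using x I card_gt_0_iff by blast
  have xs: "set xs = I - {x}" "length xs = k - 1" using I x by (auto simp: xs_def)
  have zs: "set zs = J" "length zs = k" using J by (auto simp: zs_def)
  have zero: "column_det a (y # xs) = 0" if "y \<in> J" for y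
  proof (cases "y \<in> I")
    case True
    then show ?thesis using that x xs by (intro column_det_repeated) auto
  next
    case False
    then have "minor a (insert y (I - {x})) = 0" using no that by blast
    then show ?thesis
      unfolding xs_def using column_det_sorted_insert[of "I - {x}" y a] I False by simp
  qed
  have "insert x (I - {x}) = I" using x by auto
  then have "column_det a (x # xs) = (- 1) ^ card {y \<in> I - {x}. y < x} * minor a I"
    using column_det_sorted_insert[of "I - {x}" x a] I(1) unfolding xs_def by simp
  then have "column_det a (x # xs) \<noteq> 0" using I(3) by simp
  have "{..length xs} = {0..<k}" using xs(2) \<open>0 < k\<close> by auto
  then have expand: "column_det a (y # xs) = (\<Sum>i = 0..<k. a i y * column_cofactor a xs i)" for y
    by (simp only: column_det_Cons)
  define M where "M = mat k k (\<lambda>(i, t). a i (zs ! t))"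
  define v where "v = vec k (column_cofactor a xs)"
  have M: "transpose_mat M \<in> carrier_mat k k" by (simp add: M_def)
  have "det (transpose_mat M) = det M" by (rule det_transpose[of M k]) (simp add: M_def)
  also have "\<dots> \<noteq> 0" using J(3) zs by (simp add: minor_def column_det_def M_def flip: zs_def)
  finally have "det (transpose_mat M) \<noteq> 0" .
  moreover have "transpose_mat M *\<^sub>v v = 0\<^sub>v k"
  proof (rule eq_vecI)
    fix t assume "t < dim_vec (0\<^sub>v k)"
    then have t: "t < k" by simp
    then have "zs ! t \<in> J" using zs by auto
    then have "(\<Sum>i = 0..<k. a i (zs ! t) * column_cofactor a xs i) = 0"
      using zero expand by metis
    then show "(transpose_mat M *\<^sub>v v) $ t = 0\<^sub>v k $ t"
      using t by (simp add: M_def v_def scalar_prod_def)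
  qed (simp add: M_def)
  ultimately have "v = 0\<^sub>v k"
    using det_0_iff_vec_prod_zero[OF M] vec_carrier[of k "column_cofactor a xs"] unfolding v_def by blast
  then have "column_cofactor a xs i = 0" if "i < k" for i
    using that by (metis index_vec index_zero_vec(1) v_def)
  then have "column_det a (x # xs) = 0" unfolding expand by simp
  with \<open>column_det a (x # xs) \<noteq> 0\<close> show False ..
qed

text \<open>\<open>pick J\<close> lists the matrix columns in increasing order from 0; shifted by
  one it is the sorted list of the labels in \<open>I\<close>.\<close>

lemma det_submatrix_minor:
  assumes A: "A \<in> carrier_mat k n" and I: "I \<subseteq> {1..n}" "card I = k"
    and a: "\<And>i c. i < k \<Longrightarrow> c < n \<Longrightarrow> A $$ (i, c) = a i (Suc c)"
  shows "det (submatrix A UNIV {c. c + 1 \<in> I}) = minor a I"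
proof -
  define J where "J = {c. c + 1 \<in> I}"
  have fin: "finite I" using I(1) by (rule finite_subset) simp
  have J: "J = (\<lambda>x. x - 1) ` I" unfolding J_def using I(1) by (force simp: image_iff)
  have cardJ: "card J = k"
    unfolding J I(2)[symmetric]
  proof (intro card_image inj_onI)
    fix x y assume "x \<in> I" "y \<in> I" "x - 1 = y - 1"
    moreover from this have "1 \<le> x" "1 \<le> y" using I(1) by auto
    ultimately show "x = y" by linarith
  qed
  have finJ: "finite J" unfolding J using fin by simp
  have pick_in: "Suc (pick J t) \<in> I" if "t < k" for t
    using pick_in_set_le[of t J] that cardJ by (simp add: J_def)
  have pick_less: "pick J s < pick J t" if "s < t" "t < k" for s t
    using pick_mono_le[of t J s] that cardJ by simp
  let ?zs = "map (\<lambda>t. Suc (pick J t)) [0..<k]"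
  have "sorted_wrt (<) ?zs"
    by (auto simp: sorted_wrt_iff_nth_less pick_less)
  then have zs: "sorted ?zs" "distinct ?zs" by (auto simp: strict_sorted_iff)
  have "set ?zs = I"
  proof (rule card_subset_eq[OF fin])
    show "set ?zs \<subseteq> I" using pick_in by auto
    show "card (set ?zs) = card I" using distinct_card[OF zs(2)] I(2) by simp
  qed
  then have "sorted_list_of_set I = ?zs"
    using zs by (metis sorted_list_of_set.idem_if_sorted_distinct)
  then have "minor a I = det (mat k k (\<lambda>(i, t). a i (Suc (pick J t))))"
    unfolding minor_def column_det_def by (auto intro!: arg_cong[where f = det] eq_matI)
  also have "mat k k (\<lambda>(i, t). a i (Suc (pick J t))) = submatrix A UNIV J"
  proof -
    have "{j. j < n \<and> j \<in> J} = J" using I(1) by (auto simp: J_def)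
    then have "{j. j < dim_col A \<and> j \<in> J} = J" using A by simp
    moreover have "{i. i < dim_row A \<and> i \<in> UNIV} = {..<k}" using A by auto
    moreover have "pick J t < n" if "t < k" for t using pick_in[OF that] I(1) by auto
    ultimately show ?thesis
      unfolding submatrix_def using cardJ a
      by (intro eq_matI) (simp_all add: pick_UNIV)
  qed
  finally show ?thesis by (simp only: J_def)
qed

lemma matroid_of_matrix_is_matroid:
  assumes A: "A \<in> carrier_mat k n" and "bases (matroid_of_matrix A) \<noteq> {}"
  shows "is_matroid (matroid_of_matrix A)"
proof -
  define a where "a = (\<lambda>i c. A $$ (i, c - 1))"
  have det: "det (submatrix A UNIV {c. c + 1 \<in> I}) = minor a I"
    if "I \<subseteq> {1..n}" "card I = k" for I
    by (rule det_submatrix_minor[OF A that]) (simp add: a_def)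
  have bases: "I \<in> bases (matroid_of_matrix A) \<longleftrightarrow>
      I \<subseteq> {1..n} \<and> card I = k \<and> minor a I \<noteq> 0" for I
    using A det[of I] by (auto simp: matroid_of_matrix_def)
  have "\<exists>y \<in> J - I. insert y (I - {x}) \<in> bases (matroid_of_matrix A)"
    if I: "I \<in> bases (matroid_of_matrix A)" and J: "J \<in> bases (matroid_of_matrix A)"
      and x: "x \<in> I - J" for I J x
  proof -
    have fin: "finite I" "finite J" using I J bases by (auto intro: finite_subset)
    obtain y where y: "y \<in> J - I" "minor a (insert y (I - {x})) \<noteq> 0"
      using minor_exchange[OF fin(1) _ _ fin(2) _ _ x] I J bases by blast
    moreover have "card (insert y (I - {x})) = k"
      using y(1) x fin I bases card_Suc_Diff1[of I x] by simp
    ultimately show ?thesis using I J bases by (intro bexI[of _ y]) auto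
  qed
  then show ?thesis
    using assms(2) unfolding is_matroid_def
    by (intro conjI ballI) (auto simp: matroid_of_matrix_def)
qed

section \<open>Minimality of presentations with private elements\<close>

lemma is_transversal_permute:
  assumes "is_transversal S I" "mset T = mset S"
  shows "is_transversal T I"
proof -
  obtain \<phi> where \<phi>: "bij_betw \<phi> {..<length S} I" "\<forall>j<length S. \<phi> j \<in> S ! j"
    using assms(1) by (auto simp: is_transversal_def)
  obtain p where p: "p permutes {..<length S}" "permute_list p S = T"
    using mset_eq_permutation[OF assms(2)] by auto
  have len: "length T = length S" using assms(2) by (rule mset_eq_length)
  have "bij_betw (\<phi> \<circ> p) {..<length T} I"
    unfolding len by (rule bij_betw_trans[OF permutes_imp_bij[OF p(1)] \<phi>(1)])
  moreover have "(\<phi> \<circ> p) j \<in> T ! j" if "j < length T" for j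
  proof -
    have "T ! j = S ! p j" using permute_list_nth[OF p(1)] p(2) that len by metis
    moreover have "p j < length S" using permutes_in_image[OF p(1), of j] that len by simp
    ultimately show ?thesis using \<phi>(2) by simp
  qed
  ultimately show ?thesis by (auto simp: is_transversal_def)
qed

text \<open>Each \<open>x\<close> in \<open>S ! i\<close> is tested by the transversal formed by
  \<open>x\<close> and the private elements of the other sets. In a smaller presentation a private
  element can only represent its own set, which leaves set \<open>i\<close> to contain
  \<open>x\<close>.\<close>

lemma fundamental_presentation_minimal:
  assumes S: "presentation S M"
    and priv: "\<And>i. i < length S \<Longrightarrow> e i \<in> S ! i"
      "\<And>i j. i < length S \<Longrightarrow> j < length S \<Longrightarrow> j \<noteq> i \<Longrightarrow> e i \<notin> S ! j"
  shows "minimal_presentation S M"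
  unfolding minimal_presentation_def
proof (intro conjI allI impI)
  fix S' assume "presentation S' M \<and> (\<exists>T. mset T = mset S' \<and> list_all2 (\<subseteq>) T S)"
  then obtain T where S': "presentation S' M" and T: "mset T = mset S'" "list_all2 (\<subseteq>) T S"
    by blast
  have len: "length T = length S" using T(2) by (rule list_all2_lengthD)
  have sub: "T ! i \<subseteq> S ! i" if "i < length S" for i
    using T(2) that len by (auto simp: list_all2_conv_all_nth)
  have T_trans: "is_transversal T I" if "is_transversal S I" for I
  proof -
    have "I \<subseteq> ground M"
      using that S unfolding is_transversal_def presentation_def bij_betw_def
      by (metis (no_types, lifting) image_subsetI lessThan_iff nth_mem subsetD)
    then have "I \<in> bases (matroid_of_system (ground M) S)"
      using that by (simp add: matroid_of_system_def)
    also have "matroid_of_system (ground M) S = matroid_of_system (ground M) S'"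
      using S S' by (metis presentation_def)
    finally have "is_transversal S' I" by (simp add: matroid_of_system_def)
    then show ?thesis using T(1) by (rule is_transversal_permute)
  qed
  have "S ! i \<subseteq> T ! i" if i: "i < length S" for i
  proof
    fix x assume x: "x \<in> S ! i"
    \<comment> \<open>Injective because \<open>x\<close> lies in \<open>S ! i\<close> and so is not
      the private element of another set.\<close>
    define \<phi> where "\<phi> = e(i := x)"
    have inj: "inj_on \<phi> {..<length S}"
      unfolding inj_on_def \<phi>_def using priv x i by (metis fun_upd_apply lessThan_iff)
    have "is_transversal S (\<phi> ` {..<length S})"
      unfolding is_transversal_def
      using inj priv(1) x by (intro exI[of _ \<phi>]) (auto simp: bij_betw_def \<phi>_def)
    then have "is_transversal T (\<phi> ` {..<length S})" by (rule T_trans)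
    then obtain \<psi> where \<psi>: "bij_betw \<psi> {..<length S} (\<phi> ` {..<length S})"
        "\<And>j. j < length S \<Longrightarrow> \<psi> j \<in> T ! j"
      unfolding is_transversal_def len by blast
    have onto: "\<exists>j'<length S. \<psi> j' = \<phi> j" if "j < length S" for j
    proof -
      have "\<phi> j \<in> \<psi> ` {..<length S}" using \<psi>(1) that by (simp add: bij_betw_def)
      then show ?thesis by auto
    qed
    have \<psi>_eq: "\<psi> j = e j" if j: "j < length S" "j \<noteq> i" for j
    proof -
      obtain j' where j': "j' < length S" "\<psi> j' = e j"
        using onto[OF j(1)] j(2) by (auto simp: \<phi>_def)
      then have "e j \<in> S ! j'" using \<psi>(2) sub by force
      then show ?thesis using priv(2)[OF j(1) j'(1)] j'(2) by blast
    qed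
    obtain j' where j': "j' < length S" "\<psi> j' = x" using onto[OF i] by (auto simp: \<phi>_def)
    have "j' = i"
    proof (rule ccontr)
      assume "j' \<noteq> i"
      then have "x = e j'" using \<psi>_eq j' by simp
      then show False using priv(2)[OF j'(1) i] \<open>j' \<noteq> i\<close> x by blast
    qed
    then show "x \<in> T ! i" using \<psi>(2) j' by blast
  qed
  then have "T = S" using len sub by (intro nth_equalityI) auto
  then show "mset S' = mset S" using T(1) by simp
qed (rule S)

section \<open>Relative position of two row supports, and the properties of the positroid\<close>

context sq_network
begin

lemma row_support_cases:
  assumes "x \<in> row_support B i"
  obtains "x = src i" | l where "x = snk l" "(i, l) \<in> B"
  using assms by (auto simp: row_support_def)

lemma row_support_min: "x \<in> row_support B i \<Longrightarrow> src i \<le> x"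
  using src_less_snk B_box by (elim row_support_cases) (auto intro: less_imp_le)

text \<open>Among the labels from the source of the lower row \<open>i'\<close> on, the part of the upper row that is
  not shared lies beyond the whole lower row (from the Le condition), and the part of the lower
  row that is not shared lies before the whole upper row (from the Sq condition).\<close>

lemma upper_row_beyond:
  assumes i: "i \<in> {1..k}" "i' \<in> {1..k}" "i < i'"
    and x: "x \<in> row_support B i" "x \<notin> row_support B i'" "src i' \<le> x"
    and y: "y \<in> row_support B i'"
  shows "y < x"
proof -
  have "x \<noteq> src i" using src_less_iff[OF i(1,2)] i(3) x(3) by auto
  then obtain l where l: "x = snk l" "(i, l) \<in> B" using x(1) by (auto simp: row_support_def)
  have "x \<noteq> src i'" using x(2) by (auto simp: row_support_def)
  then have less: "src i' < x" using x(3) by simp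
  have lm: "l \<in> {1..m}" using B_box[OF l(2)] by simp
  have Y: "(i', l) \<in> Y" using less l(1) src_less_snk_iff[OF i(2) lm] by simp
  show ?thesis
    using y
  proof (cases rule: row_support_cases)
    case 1
    then show ?thesis using less by simp
  next
    case (2 l')
    have l'm: "l' \<in> {1..m}" using B_box[OF 2(2)] by simp
    have "(i', l) \<notin> B" using x(2) l(1) by (auto simp: row_support_def)
    then have "\<not> l' < l" "l' \<noteq> l"
      using sq_diagram_le[OF sq i(3) _ Y l(2)] 2(2) by auto
    then show ?thesis using l(1) 2(1) snk_less_iff[OF l'm lm] by simp
  qed
qed

lemma lower_row_before:
  assumes i: "i \<in> {1..k}" "i' \<in> {1..k}" "i < i'"
    and y: "y \<in> row_support B i'" "y \<notin> row_support B i"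
    and x: "x \<in> row_support B i" "src i' \<le> x"
  shows "y < x"
proof -
  have "x \<noteq> src i" using src_less_iff[OF i(1,2)] i(3) x(2) by auto
  then obtain l where l: "x = snk l" "(i, l) \<in> B" using x(1) by (auto simp: row_support_def)
  have lm: "l \<in> {1..m}" using B_box[OF l(2)] by simp
  have less: "src i' < x" using x(2) l(1) src_neq_snk[OF i(2) lm] by simp
  have Y: "(i', l) \<in> Y" using less l(1) src_less_snk_iff[OF i(2) lm] by simp
  show ?thesis
    using y(1)
  proof (cases rule: row_support_cases)
    case 1
    then show ?thesis using less by simp
  next
    case (2 l')
    have l'm: "l' \<in> {1..m}" using B_box[OF 2(2)] by simp
    have "(i, l') \<notin> B" using y(2) 2(1) by (auto simp: row_support_def)
    \<comment> \<open>If \<open>l' < l\<close>, the Le condition gives a bullet at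
      \<open>(i', l)\<close>, which supplies the third corner for Sq to force a bullet at
      \<open>(i, l')\<close>.\<close>
    then have "\<not> l' < l" "l' \<noteq> l"
      using sq_diagram_sq[OF sq i(3) _ l(2) 2(2)] sq_diagram_le[OF sq i(3) _ Y l(2) 2(2)] l(2)
      by auto
    then show ?thesis using l(1) 2(1) snk_less_iff[OF l'm lm] by simp
  qed
qed

text \<open>For \<open>a\<close>, \<open>b\<close>, \<open>c\<close>, \<open>d\<close> in cyclic
  order the pairs \<open>a\<close>, \<open>c\<close> and \<open>b\<close>, \<open>d\<close>
  interlace also in the usual order, so \<open>a\<close> and \<open>c\<close> cannot both lie
  outside the interval spanned by \<open>b\<close> and \<open>d\<close>. The primed version
  exchanges the two pairs.\<close>

lemma cyclic_not_separated:
  assumes "cyclic_less a a b" "cyclic_less a b c" "cyclic_less a c d"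
    and "a < b \<and> a < d \<or> b < a \<and> d < a" "c < b \<and> c < d \<or> b < c \<and> d < c"
  shows False
  using assms unfolding cyclic_less_def by linarith

lemma cyclic_not_separated':
  assumes "cyclic_less a a b" "cyclic_less a b c" "cyclic_less a c d"
    and "b < a \<and> b < c \<or> a < b \<and> c < b" "d < a \<and> d < c \<or> a < d \<and> c < d"
  shows False
  using assms unfolding cyclic_less_def by linarith

text \<open>Labels of the upper row before \<open>src i'\<close> precede the whole lower row; from
  \<open>src i'\<close> on the two preceding comparisons apply. So an unshared label of the upper
  row is never between two labels of the lower one, and no label of the upper row is between two
  unshared labels of the lower one. Each statement excludes one direction of crossing.\<close>

lemma row_supports_noncrossing:
  assumes i: "i \<in> {1..k}" "i' \<in> {1..k}" "i < i'"
  shows "\<not> crosses n (row_support B i) (row_support B i')"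
    and "\<not> crosses n (row_support B i') (row_support B i)"
proof -
  have "z < y \<and> z < y' \<or> y < z \<and> y' < z"
    if "z \<in> row_support B i" "z \<notin> row_support B i'" "y \<in> row_support B i'" "y' \<in> row_support B i'"
    for z y y'
    using upper_row_beyond[OF i that(1,2) _ that(3)] upper_row_beyond[OF i that(1,2) _ that(4)]
      row_support_min[OF that(3)] row_support_min[OF that(4)] by linarith
  then show "\<not> crosses n (row_support B i) (row_support B i')"
    unfolding crosses_def using cyclic_not_separated by (metis (full_types))
  have "z < y \<and> z < y' \<or> y < z \<and> y' < z"
    if "z \<in> row_support B i" "y \<in> row_support B i'" "y \<notin> row_support B i"
      "y' \<in> row_support B i'" "y' \<notin> row_support B i"
    for z y y'
    using lower_row_before[OF i that(2,3,1)] lower_row_before[OF i that(4,5,1)]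
      row_support_min[OF that(2)] row_support_min[OF that(4)] by linarith
  then show "\<not> crosses n (row_support B i') (row_support B i)"
    unfolding crosses_def using cyclic_not_separated' by (metis (full_types))
qed

lemma meas_positroid:
  fixes A defines "A \<equiv> Meas k (k + m) Y B w"
  shows "fundamental_transversal_matroid (matroid_of_matrix A)
    \<and> matroid_of_matrix A = matroid_of_system {1..k + m} (supp A)
    \<and> noncrossing (k + m) (supp A)
    \<and> minimal_presentation (supp A) (matroid_of_matrix A)"
proof -
  obtain T where T: "sq_matrix Y B T"
    "\<And>i c. i < k \<Longrightarrow> meas_entry k (k + m) Y B w (src (Suc i)) c = signed_matrix T i c"
    using meas_entry_sq_matrix by blast
  define a where "a = signed_matrix T"
  define U where "U = (\<lambda>i. row_support B (Suc i))"
  have A: "A \<in> carrier_mat k (k + m)" by (simp add: A_def Meas_def)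
  have entry: "A $$ (i, c) = a i (Suc c)" if "i < k" "c < k + m" for i c
    using T(2) that by (simp add: A_def Meas_def a_def)
  have pos: "positive_on_transversals k a U"
    using sq_matrix_positive[OF T(1)] by (simp add: a_def U_def)
  have nz: "a i x \<noteq> 0 \<longleftrightarrow> x \<in> U i" if "i < k" for i x
  proof
    have "(Suc i, l) \<in> B" if "T (Suc i) l \<noteq> 0" for l
      using sq_matrix_support[OF T(1), of "Suc i" l] that by (auto split: if_splits)
    moreover assume "a i x \<noteq> 0"
    ultimately show "x \<in> U i"
      using signed_matrix_nonzero[of T i x] unfolding a_def U_def row_support_def by blast
  next
    assume "x \<in> U i"
    then show "a i x \<noteq> 0"
      unfolding U_def
    proof (cases rule: row_support_cases)
      case 1
      then show ?thesis using that signed_matrix_src[of i "Suc i" T] by (simp add: a_def)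
    next
      case (2 l)
      then have "l \<in> {1..m}" using B_box by simp
      then show ?thesis
        using 2 sq_matrix_support[OF T(1), of "Suc i" l] signed_matrix_snk[of l T i]
        by (simp add: a_def label_sign_def)
    qed
  qed
  have U_range: "U i \<subseteq> {1..k + m}" if "i < k" for i
    using that src_in[of "Suc i"] snk_in B_box by (force simp: U_def row_support_def)
  have supp: "supp A = map U [0..<k]"
  proof -
    have "{c + 1 | c. c < k + m \<and> A $$ (i, c) \<noteq> 0} = U i" if i: "i < k" for i
    proof (intro equalityI subsetI)
      show "x \<in> {c + 1 | c. c < k + m \<and> A $$ (i, c) \<noteq> 0}" if x: "x \<in> U i" for x
      proof -
        have "x \<in> {1..k + m}" using U_range[OF i] x by blast
        then obtain c where "x = Suc c" "c < k + m" by (cases x) auto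
        then show ?thesis using nz[OF i, of x] entry[OF i, of c] x by auto
      qed
    qed (use entry nz i in auto)
    then show ?thesis unfolding supp_def using A by auto
  qed
  have trans: "is_transversal (supp A) I \<longleftrightarrow> has_transversal k U I" for I
    by (simp add: is_transversal_def has_transversal_def supp)
  have eq: "matroid_of_matrix A = matroid_of_system {1..k + m} (supp A)"
  proof -
    have "card I = k \<and> det (submatrix A UNIV {c. c + 1 \<in> I}) \<noteq> 0 \<longleftrightarrow> is_transversal (supp A) I"
      if I: "I \<subseteq> {1..k + m}" for I
    proof (cases "card I = k")
      case True
      have "finite I" using I by (rule finite_subset) simp
      then have "minor a I \<noteq> 0 \<longleftrightarrow> has_transversal k U I"
        using pos[unfolded positive_on_transversals_def, rule_format, of I] True
        by (simp split: if_splits)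
      then show ?thesis
        using True trans det_submatrix_minor[OF A I True, of a] entry by simp
    next
      case False
      \<comment> \<open>A transversal is in bijection with the \<open>k\<close> rows, so sets of
        another size are bases on neither side.\<close>
      then have "\<not> has_transversal k U I"
        unfolding has_transversal_def using bij_betw_same_card by fastforce
      then show ?thesis using False trans by simp
    qed
    then show ?thesis using A unfolding matroid_of_matrix_def matroid_of_system_def by auto
  qed
  have priv: "src (Suc i) \<in> supp A ! i" if "i < length (supp A)" for i
    using that by (simp add: supp U_def row_support_def)
  have priv': "src (Suc i) \<notin> supp A ! j"
    if "i < length (supp A)" "j < length (supp A)" "j \<noteq> i" for i j
  proof -
    have "Suc i \<in> {1..k}" "Suc j \<in> {1..k}" using that by (auto simp: supp)
    then show ?thesis
      using that src_eq_iff[of "Suc i" "Suc j"] src_neq_snk[of "Suc i"] B_box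
      by (auto simp: supp U_def row_support_def)
  qed
  have sources_trans: "is_transversal (supp A) ((\<lambda>i. src (Suc i)) ` {..<length (supp A)})"
    unfolding is_transversal_def
  proof (intro exI conjI)
    show "bij_betw (\<lambda>i. src (Suc i)) {..<length (supp A)}
        ((\<lambda>i. src (Suc i)) ` {..<length (supp A)})"
      using priv priv' by (intro inj_on_imp_bij_betw inj_onI) (metis lessThan_iff)
  qed (use priv in blast)
  have ground: "ground (matroid_of_matrix A) = {1..k + m}"
    using A by (simp add: matroid_of_matrix_def)
  have pres: "presentation (supp A) (matroid_of_matrix A)"
    unfolding presentation_def
  proof (intro conjI)
    show "\<forall>X \<in> set (supp A). X \<subseteq> ground (matroid_of_matrix A)"
      using U_range A by (auto simp: supp matroid_of_matrix_def)
    show "matroid_of_matrix A = matroid_of_system (ground (matroid_of_matrix A)) (supp A)"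
      unfolding ground by (rule eq)
  qed (use sources_trans in blast)
  have "bases (matroid_of_matrix A) \<noteq> {}"
  proof -
    have "(\<lambda>i. src (Suc i)) ` {..<length (supp A)} \<subseteq> {1..k + m}"
      using src_in by (auto simp: supp)
    then show ?thesis using sources_trans eq by (auto simp: matroid_of_system_def)
  qed
  then have "fundamental_transversal_matroid (matroid_of_matrix A)"
    unfolding fundamental_transversal_matroid_def transversal_matroid_def
    using matroid_of_matrix_is_matroid[OF A] pres priv priv' by blast
  moreover have "noncrossing (k + m) (supp A)"
    unfolding noncrossing_def
  proof (intro notI, elim exE conjE)
    fix i j assume ij: "i < length (supp A)" "j < length (supp A)"
      and cr: "crosses (k + m) (supp A ! i) (supp A ! j)"
    have k: "Suc i \<in> {1..k}" "Suc j \<in> {1..k}" using ij by (auto simp: supp)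
    have cr': "crosses (k + m) (row_support B (Suc i)) (row_support B (Suc j))"
      using cr ij by (simp add: supp U_def)
    consider "i < j" | "j < i" | "i = j" by linarith
    then show False
    proof cases
      case 3
      then show ?thesis using cr' by (auto simp: crosses_def)
    qed (use row_supports_noncrossing k cr' in auto)
  qed
  moreover have "minimal_presentation (supp A) (matroid_of_matrix A)"
    by (rule fundamental_presentation_minimal[OF pres priv priv'])
  ultimately show ?thesis using eq by blast
qed

end

theorem theorem3p6:
  fixes k n :: nat
    and Y B :: "(nat \<times> nat) set"
    and w :: "net_vertex \<times> net_vertex \<Rightarrow> real"
  assumes "k \<le> n"
    and "sq_diagram Y B"
    and "fits_in_box Y k (n - k)"
    and "network_weighting k n Y B w"
  shows "fundamental_transversal_matroid (matroid_of_matrix (Meas k n Y B w))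
       \<and> matroid_of_matrix (Meas k n Y B w) = matroid_of_system {1..n} (supp (Meas k n Y B w))
       \<and> noncrossing n (supp (Meas k n Y B w))
       \<and> minimal_presentation (supp (Meas k n Y B w)) (matroid_of_matrix (Meas k n Y B w))"
proof -
  have n: "k + (n - k) = n" using assms(1) by simp
  have "young_diagram Y" using assms(2) by (simp add: sq_diagram_def le_diagram_def)
  then interpret sq_network k "n - k" Y B w
    using assms by unfold_locales simp_all
  show ?thesis using meas_positroid unfolding n .
qed

end
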